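(* There is a constant $c$ such that for every $n\in\mathbb{N}_{\ge1}$ there exists a language $L_n$ recognized by a non-deterministic weak Muller automaton $\mathfrak{A}_n$ with Emerson–Lei acceptance condition, of size at most $c\cdot n^3$, such that Player $O$ wins $\Gamma_f(L_n)$ for some constant delay function $f$, but Player $I$ wins $\Gamma_g(L_n)$ for every delay function $g$ with $\sum_{i=0}^{(n+2)\cdot 2^n}g(i)\le 2^{2^{2^n}}$.
   Context: An $\omega$-automaton $\mathfrak{A}=(Q,\Sigma,q_I,\Delta,\mathrm{Acc})$ has finite state set $Q$, alphabet $\Sigma$, initial state $q_I$, transitions $\Delta\subseteq Q\times\Sigma\times Q$, accepting runs $\mathrm{Acc}\subseteq\Delta^\omega$; $L(\mathfrak{A})$ is the set of words processed by some initial accepting run (runs $(q_0,a_0,q_1)(q_1,a_1,q_2)\cdots$ with $q_0=q_I$ processing $a_0a_1\cdots$). A weak Muller automaton has $\mathcal{F}\subseteq 2^Q$ and accepts runs whose set of visited states lies in $\mathcal{F}$. Emerson–Lei representation: $\mathcal{F}$ is given by a Boolean formula $\varphi$ over variables $Q$, $\mathcal{F}$ being the sets $F\subseteq Q$ such that the assignment making exactly the elements of $F$ true satisfies $\varphi$; the size of the automaton is $|Q|+|\varphi|$. A delay function is $f:\mathbb{N}\to\mathbb{N}_{\ge1}$; it is constant if $f(i)=1$ for all $i>0$. In the delay game $\Gamma_f(L)$, $L\subseteq(\Sigma_I\times\Sigma_O)^\omega$, in round $i=0,1,\dots$ Player $I$ picks $u_i\in\Sigma_I^{f(i)}$ and then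 Player $O$ picks $v_i\in\Sigma_O$; $O$ wins the play iff $\binom{u_0u_1\cdots}{v_0v_1\cdots}\in L$. Strategies: $\tau_I:\Sigma_O^*\to\Sigma_I^*$ with $|\tau_I(w)|=f(|w|)$, $\tau_O:\Sigma_I^+\to\Sigma_O$; a player wins the game if she/he has a strategy winning all consistent plays. *)

theory Defs
  imports Main
begin

datatype 'q bform = BTrue | BFalse | BVar 'q | BNot "'q bform"
  | BAnd "'q bform" "'q bform" | BOr "'q bform" "'q bform"

fun beval :: "('q \<Rightarrow> bool) \<Rightarrow> 'q bform \<Rightarrow> bool" where
  "beval v BTrue = True"
| "beval v BFalse = False"
| "beval v (BVar q) = v q"
| "beval v (BNot p) = (\<not> beval v p)"
| "beval v (BAnd p r) = (beval v p \<and> beval v r)"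
| "beval v (BOr p r) = (beval v p \<or> beval v r)"

fun bsize :: "'q bform \<Rightarrow> nat" where
  "bsize BTrue = 1"
| "bsize BFalse = 1"
| "bsize (BVar q) = 1"
| "bsize (BNot p) = 1 + bsize p"
| "bsize (BAnd p r) = 1 + bsize p + bsize r"
| "bsize (BOr p r) = 1 + bsize p + bsize r"

fun bvars :: "'q bform \<Rightarrow> 'q set" where
  "bvars BTrue = {}"
| "bvars BFalse = {}"
| "bvars (BVar q) = {q}"
| "bvars (BNot p) = bvars p"
| "bvars (BAnd p r) = bvars p \<union> bvars r"
| "bvars (BOr p r) = bvars p \<union> bvars r"

record ('q, 'a) wm_aut =
  states :: "'q set"
  alph :: "'a set"
  init :: 'q
  trans :: "('q \<times> 'a \<times> 'q) set"
  accf :: "'q bform"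

definition wf_wm :: "('q, 'a) wm_aut \<Rightarrow> bool" where
  "wf_wm A \<longleftrightarrow> finite (states A) \<and> finite (alph A) \<and> init A \<in> states A
     \<and> trans A \<subseteq> states A \<times> alph A \<times> states A \<and> bvars (accf A) \<subseteq> states A"

definition wm_size :: "('q, 'a) wm_aut \<Rightarrow> nat" where
  "wm_size A = card (states A) + bsize (accf A)"

definition wm_accepting_run :: "('q, 'a) wm_aut \<Rightarrow> (nat \<Rightarrow> 'a) \<Rightarrow> (nat \<Rightarrow> 'q) \<Rightarrow> bool" where
  "wm_accepting_run A w \<rho> \<longleftrightarrow> \<rho> 0 = init A
     \<and> (\<forall>i. (\<rho> i, w i, \<rho> (Suc i)) \<in> trans A)
     \<and> beval (\<lambda>q. q \<in> range \<rho>) (accf A)"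

definition wm_lang :: "('q, 'a) wm_aut \<Rightarrow> (nat \<Rightarrow> 'a) set" where
  "wm_lang A = {w. \<exists>\<rho>. wm_accepting_run A w \<rho>}"

definition delay_fun :: "(nat \<Rightarrow> nat) \<Rightarrow> bool" where
  "delay_fun f \<longleftrightarrow> (\<forall>i. f i \<ge> 1)"

definition constant_delay :: "(nat \<Rightarrow> nat) \<Rightarrow> bool" where
  "constant_delay f \<longleftrightarrow> delay_fun f \<and> (\<forall>i>0. f i = 1)"

text \<open>Infinite word u_0 u_1 ... obtained by concatenating the blocks (each of length >= 1).\<close>
definition flat :: "(nat \<Rightarrow> 'a list) \<Rightarrow> nat \<Rightarrow> 'a" where
  "flat us k = concat (map us [0..<Suc k]) ! k"

definition O_wins :: "'i set \<Rightarrow> 'o set \<Rightarrow> (nat \<Rightarrow> nat) \<Rightarrow> (nat \<Rightarrow> 'i \<times> 'o) set \<Rightarrow> bool" where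
  "O_wins SI SO f L \<longleftrightarrow> (\<exists>\<tau>O :: 'i list \<Rightarrow> 'o.
     (\<forall>ws. ws \<in> lists SI \<and> ws \<noteq> [] \<longrightarrow> \<tau>O ws \<in> SO) \<and>
     (\<forall>us :: nat \<Rightarrow> 'i list. (\<forall>i. length (us i) = f i \<and> set (us i) \<subseteq> SI) \<longrightarrow>
        (\<lambda>k. (flat us k, \<tau>O (concat (map us [0..<Suc k])))) \<in> L))"

definition I_wins :: "'i set \<Rightarrow> 'o set \<Rightarrow> (nat \<Rightarrow> nat) \<Rightarrow> (nat \<Rightarrow> 'i \<times> 'o) set \<Rightarrow> bool" where
  "I_wins SI SO f L \<longleftrightarrow> (\<exists>\<tau>I :: 'o list \<Rightarrow> 'i list.
     (\<forall>vs \<in> lists SO. length (\<tau>I vs) = f (length vs) \<and> set (\<tau>I vs) \<subseteq> SI) \<and>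
     (\<forall>vs :: nat \<Rightarrow> 'o. (\<forall>i. vs i \<in> SO) \<longrightarrow>
        (\<lambda>k. (flat (\<lambda>i. \<tau>I (map vs [0..<i])) k, vs k)) \<notin> L))"

end

theory Submission
  imports Defs
begin

text \<open>
  Put \<open>m = 2 ^ n\<close>. The word is cut into slots of \<open>n + 1\<close> letters: Player O spells an \<open>n\<close>-bit address,
  which has to be incremented modulo \<open>m\<close> from slot to slot, and the last letter of a slot carries one
  data bit of each player. A block is a run of \<open>m\<close> slots through all addresses. In block 0 Player O
  commits to an \<open>m\<close>-bit number \<open>j\<close>; every later block \<open>b\<close> holds a number \<open>d b\<close> of Player I. Player O
  claims to know blocks \<open>p < q\<close> with \<open>d p = d q = j\<close> and \<open>d b < j\<close> for \<open>p < b < q\<close>: she marks, in each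
  block from \<open>p\<close> on, the longest prefix on which \<open>d b\<close> agrees with \<open>j\<close>, and the first unmarked address
  must witness \<open>d b < j\<close>. Afterwards Player I may spell an address \<open>k\<close> as a challenge, and only the
  claims at address \<open>k\<close> are verified.

  The automaton guesses \<open>k\<close>. It has too few states to remember \<open>k\<close>, so it guesses the bits of \<open>k\<close> anew
  in every slot, and the acceptance condition rejects runs that visit both values of some bit.

  Among \<open>2 ^ 2 ^ m\<close> consecutive numbers below \<open>2 ^ m\<close> there is always such a pair \<open>p < q\<close>, so Player O
  wins with a long lookahead. If Player I commits to fewer letters before \<open>j\<close> is known, he plays
  the ruler sequence, which has no such pair, then the complement of \<open>j\<close> forever, and he
  challenges an address at which Player O has lied.
\<close>

section \<open>Binary numbers and the ruler sequence\<close>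

fun bin :: "nat \<Rightarrow> (nat \<Rightarrow> bool) \<Rightarrow> nat" where
  "bin 0 f = 0"
| "bin (Suc n) f = bin n f + (if f n then 2 ^ n else 0)"

lemma bin_less: "bin n f < 2 ^ n"
  by (induction n) auto

lemma bin_cong: "(\<And>t. t < n \<Longrightarrow> f t = g t) \<Longrightarrow> bin n f = bin n g"
  by (induction n) auto

lemma bin_eq_iff: "bin n f = bin n g \<longleftrightarrow> (\<forall>t<n. f t = g t)"
proof (induction n)
  case (Suc n)
  have "bin (Suc n) f = bin (Suc n) g \<longleftrightarrow> bin n f = bin n g \<and> f n = g n"
    using bin_less[of n f] bin_less[of n g] by auto
  then show ?case
    using Suc less_Suc_eq by auto
qed simp

lemma bin_eq_max_iff: "bin n f = 2 ^ n - 1 \<longleftrightarrow> (\<forall>t<n. f t)"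
proof -
  have "bin n (\<lambda>_. True) = 2 ^ n - 1"
    by (induction n) auto
  then show ?thesis
    using bin_eq_iff[of n f "\<lambda>_. True"] by auto
qed

lemma bin_surj: "x < 2 ^ n \<Longrightarrow> \<exists>f. bin n f = x"
proof (induction n arbitrary: x)
  case (Suc n)
  define y where "y = (if x < 2 ^ n then x else x - 2 ^ n)"
  have "y < 2 ^ n"
    using Suc.prems by (auto simp: y_def)
  then obtain f where f: "bin n f = y"
    using Suc.IH by blast
  have "bin n (f(n := (x \<ge> 2 ^ n))) = bin n f"
    by (rule bin_cong) auto
  then have "bin (Suc n) (f(n := (x \<ge> 2 ^ n))) = x"
    using f by (auto simp: y_def)
  then show ?case by blast
qed simp

text \<open>Ripple carry: bit \<open>t\<close> flips exactly when all lower bits are set. One flag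
  for the conjunction of the lower bits therefore suffices for a bitwise check.\<close>

definition incr :: "(nat \<Rightarrow> bool) \<Rightarrow> nat \<Rightarrow> bool" where
  "incr g t = (g t \<noteq> (\<forall>u<t. g u))"

text \<open>The carry reaches bit \<open>n\<close> exactly when the lower \<open>n\<close> bits are
  all set, that is, when incrementing their value overflows to \<open>2 ^ n\<close>.\<close>

lemma bin_incr: "bin n (incr g) = Suc (bin n g) mod 2 ^ n"
proof (induction n)
  case (Suc n)
  show ?case
  proof (cases "\<forall>u<n. g u")
    case True
    then have "bin n g = 2 ^ n - 1" unfolding bin_eq_max_iff by blast
    then have e: "Suc (bin n g) = 2 ^ n" by simp
    then have "Suc (bin (Suc n) g) = (if g n then 2 * 2 ^ n else 2 ^ n)" by simp
    moreover have "bin (Suc n) (incr g) = (if g n then 0 else 2 ^ n)"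
      using Suc True e incr_def[of g n] by auto
    ultimately show ?thesis by simp
  next
    case False
    then have "bin n g \<noteq> 2 ^ n - 1" unfolding bin_eq_max_iff by blast
    then have "Suc (bin n g) < 2 ^ n"
      using bin_less[of n g] by linarith
    then show ?thesis
      using Suc False incr_def[of g n] by auto
  qed
qed simp

text \<open>Unlike in \<open>bin\<close>, index 0 is the most significant bit: two numbers are then
  compared at the first address, in reading order, at which they differ.\<close>

fun val :: "nat \<Rightarrow> (nat \<Rightarrow> bool) \<Rightarrow> nat" where
  "val 0 d = 0"
| "val (Suc m) d = 2 * val m d + (if d m then 1 else 0)"

lemma val_less: "val m d < 2 ^ m"
  by (induction m) auto

lemma val_cong: "(\<And>a. a < m \<Longrightarrow> d a = e a) \<Longrightarrow> val m d = val m e"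
  by (induction m) auto

text \<open>Appending one bit on each side keeps a strict inequality, since \<open>x < y\<close>
  gives \<open>2 * x + 1 < 2 * y\<close>.\<close>

lemma val_less_if_lex:
  assumes "a < m" "\<And>b. b < a \<Longrightarrow> d b = e b" "\<not> d a" "e a"
  shows "val m d < val m e"
  using assms
proof (induction m)
  case (Suc m)
  show ?case
  proof (cases "a = m")
    case True
    then have "val m d = val m e"
      using Suc.prems by (intro val_cong) auto
    then show ?thesis using Suc.prems True by simp
  next
    case False
    then have "val m d < val m e" using Suc by simp
    then show ?thesis by simp
  qed
qed simp

lemma val_cases:
  assumes "val m d \<le> val m e"
  shows "(\<forall>a<m. d a = e a) \<or> (\<exists>a<m. (\<forall>b<a. d b = e b) \<and> \<not> d a \<and> e a)"
proof (rule ccontr)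
  assume *: "\<not> ?thesis"
  define a where "a = (LEAST a. a < m \<and> d a \<noteq> e a)"
  have "\<exists>a. a < m \<and> d a \<noteq> e a" using * by auto
  then have a: "a < m \<and> d a \<noteq> e a"
    unfolding a_def by (rule LeastI_ex)
  have below: "d b = e b" if "b < a" for b
    using not_less_Least[of b "\<lambda>a. a < m \<and> d a \<noteq> e a"] that a by (auto simp: a_def)
  show False
  proof (cases "d a")
    case True
    then have "val m e < val m d"
      using a below by (intro val_less_if_lex[of a]) auto
    then show False using assms by simp
  next
    case False
    then show False using * a below by blast
  qed
qed

lemma val_eq_iff: "val m d = val m e \<longleftrightarrow> (\<forall>a<m. d a = e a)"
proof
  assume eq: "val m d = val m e"
  then consider "\<forall>a<m. d a = e a" | a where "a < m" "\<forall>b<a. d b = e b" "\<not> d a" "e a"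
    using val_cases[of m d e] by auto
  then show "\<forall>a<m. d a = e a"
  proof cases
    case 2
    then show ?thesis using val_less_if_lex[of a m d e] eq by simp
  qed
next
  assume "\<forall>a<m. d a = e a"
  then show "val m d = val m e" by (intro val_cong) blast
qed

lemma val_surj: "x < 2 ^ m \<Longrightarrow> \<exists>d. val m d = x"
proof (induction m arbitrary: x)
  case (Suc m)
  have "x div 2 < 2 ^ m"
    using Suc.prems by auto
  then obtain d where d: "val m d = x div 2"
    using Suc.IH by blast
  have "val m (d(m := odd x)) = val m d"
    by (rule val_cong) auto
  then have "val (Suc m) (d(m := odd x)) = x"
    using d by (auto simp: odd_two_times_div_two_succ)
  then show ?case by blast
qed simp

text \<open>For positive \<open>b\<close> this is the exponent of 2 in \<open>b\<close>; the case
  \<open>b = 0\<close> stops the recursion.\<close>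

fun ruler :: "nat \<Rightarrow> nat" where
  "ruler b = (if b = 0 \<or> odd b then 0 else Suc (ruler (b div 2)))"

declare ruler.simps [simp del]

lemma ruler_less: "0 < b \<Longrightarrow> b < 2 ^ M \<Longrightarrow> ruler b < M"
proof (induction M arbitrary: b)
  case (Suc M)
  show ?case
  proof (cases "odd b")
    case False
    then have "0 < b div 2" "b div 2 < 2 ^ M"
      using Suc.prems by auto
    then show ?thesis
      using Suc.IH False by (subst ruler.simps) auto
  qed (simp add: ruler.simps)
qed simp

text \<open>Two odd numbers \<open>p < q\<close> have the even number \<open>Suc p\<close> between
  them. Two even ones are halved, and a number found between the halves is doubled.\<close>

lemma ruler_between:
  assumes "0 < p" "p < q" "ruler p = ruler q"
  shows "\<exists>b. p < b \<and> b < q \<and> ruler p < ruler b"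
  using assms
proof (induction p arbitrary: q rule: ruler.induct)
  case (1 p)
  show ?case
  proof (cases "odd p")
    case True
    then have 0: "ruler p = 0" by (simp add: ruler.simps)
    then have "odd q" using 1 ruler.simps[of q] by (auto split: if_splits)
    then have "Suc p < q" using True 1 by (metis Suc_lessI even_Suc)
    moreover have "ruler (Suc p) > 0" using True by (subst ruler.simps) auto
    ultimately show ?thesis using 0 by (intro exI[of _ "Suc p"]) auto
  next
    case False
    then have p: "ruler p = Suc (ruler (p div 2))" using 1 ruler.simps[of p] by auto
    then have q: "even q" "ruler q = Suc (ruler (q div 2))"
      using 1 ruler.simps[of q] by (auto split: if_splits)
    have "\<exists>b. p div 2 < b \<and> b < q div 2 \<and> ruler (p div 2) < ruler b"
    proof (rule 1(1))
      show "\<not> (p = 0 \<or> odd p)" using False 1(2) by auto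
      show "0 < p div 2" using False 1(2) by auto
      show "p div 2 < q div 2" using False q(1) 1(3) by auto
      show "ruler (p div 2) = ruler (q div 2)" using p q 1(4) by simp
    qed
    then obtain b where b: "p div 2 < b" "b < q div 2" "ruler (p div 2) < ruler b" by blast
    then have "ruler (2 * b) = Suc (ruler b)" by (subst ruler.simps) auto
    then show ?thesis using b p False q by (intro exI[of _ "2 * b"]) auto
  qed
qed

text \<open>Induction on the number of values. If the top value \<open>M\<close> occurs twice in the
  window, two successive occurrences form the pair; otherwise one half of the window avoids
  \<open>M\<close>, and the induction hypothesis applies there. By \<open>ruler_between\<close> and
  \<open>ruler_less\<close> the length \<open>2 ^ M\<close> is optimal.\<close>

lemma bad_pair_exists:
  fixes d :: "nat \<Rightarrow> nat"
  assumes "\<And>b. l \<le> b \<Longrightarrow> b < l + 2 ^ M \<Longrightarrow> d b < M"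
  shows "\<exists>p q. l \<le> p \<and> p < q \<and> q < l + 2 ^ M \<and> d p = d q \<and> (\<forall>b. p < b \<and> b < q \<longrightarrow> d b < d p)"
  using assms
proof (induction M arbitrary: l)
  case 0
  then have False by (metis less_add_same_cancel1 not_less0 order_refl power_0 zero_less_one)
  then show ?case ..
next
  case (Suc M)
  show ?case
  proof (cases "\<exists>p q. l \<le> p \<and> p < q \<and> q < l + 2 ^ Suc M \<and> d p = M \<and> d q = M")
    case True
    then obtain p where p: "l \<le> p" "d p = M" and ex: "\<exists>q. p < q \<and> q < l + 2 ^ Suc M \<and> d q = M"
      by blast
    define q where "q = (LEAST q. p < q \<and> q < l + 2 ^ Suc M \<and> d q = M)"
    have q: "p < q \<and> q < l + 2 ^ Suc M \<and> d q = M"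
      unfolding q_def using ex by (rule LeastI_ex)
    have "d b < M" if "p < b" "b < q" for b
    proof -
      have "d b \<noteq> M"
        using not_less_Least[of b "\<lambda>q. p < q \<and> q < l + 2 ^ Suc M \<and> d q = M"] that q
        by (auto simp: q_def)
      moreover have "d b < Suc M" using Suc.prems[of b] that q p by simp
      ultimately show ?thesis by simp
    qed
    then show ?thesis using p q by (intro exI[of _ p] exI[of _ q]) auto
  next
    case False
    have "\<exists>l'. l \<le> l' \<and> l' \<le> l + 2 ^ M \<and> (\<forall>b. l' \<le> b \<and> b < l' + 2 ^ M \<longrightarrow> d b \<noteq> M)"
    proof (cases "\<exists>b. l \<le> b \<and> b < l + 2 ^ M \<and> d b = M")
      case True
      then obtain b0 where b0: "l \<le> b0" "b0 < l + 2 ^ M" "d b0 = M" by blast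
      have "d b \<noteq> M" if "l + 2 ^ M \<le> b" "b < l + 2 ^ M + 2 ^ M" for b
      proof
        assume "d b = M"
        moreover have "b0 < b" "b < l + 2 ^ Suc M" using that b0 by auto
        ultimately show False using False b0 by blast
      qed
      then show ?thesis by (intro exI[of _ "l + 2 ^ M"]) auto
    next
      case False
      then show ?thesis by (intro exI[of _ l]) auto
    qed
    then obtain l' where l': "l \<le> l'" "l' \<le> l + 2 ^ M" "\<And>b. l' \<le> b \<Longrightarrow> b < l' + 2 ^ M \<Longrightarrow> d b \<noteq> M"
      by blast
    have "d b < M" if "l' \<le> b" "b < l' + 2 ^ M" for b
      using l' Suc.prems[of b] that by (simp add: less_Suc_eq)
    from Suc.IH[OF this] obtain p q where
      "l' \<le> p" "p < q" "q < l' + 2 ^ M" "d p = d q" "\<forall>b. p < b \<and> b < q \<longrightarrow> d b < d p"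
      by blast
    then show ?thesis using l' by (intro exI[of _ p] exI[of _ q]) auto
  qed
qed

section \<open>Weak Muller automata over arbitrary finite state sets\<close>

lemma disjunction_formula:
  assumes "finite Q"
  shows "\<exists>\<phi>. bvars \<phi> \<subseteq> Q \<and> bsize \<phi> \<le> 2 * card Q + 1 \<and> (\<forall>v. beval v \<phi> = (\<exists>q\<in>Q. P q \<and> v q))"
  using assms
proof (induction Q)
  case empty
  show ?case by (intro exI[of _ BFalse]) simp
next
  case (insert q Q)
  then obtain \<phi> where "bvars \<phi> \<subseteq> Q" "bsize \<phi> \<le> 2 * card Q + 1"
    "\<forall>v. beval v \<phi> = (\<exists>q\<in>Q. P q \<and> v q)" by blast
  then show ?case
    using insert.hyps by (intro exI[of _ "if P q then BOr (BVar q) \<phi> else \<phi>"]) (simp add: subset_insertI2)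
qed

text \<open>One conjunct per bit, each of size linear in \<open>card Q\<close>. With linearly many
  states the formula is quadratic in \<open>n\<close>, whereas storing an \<open>n\<close>-bit guess
  in the state would cost a factor \<open>2 ^ n\<close>.\<close>

lemma exclusion_formula:
  assumes "finite Q"
  shows "\<exists>\<phi>. bvars \<phi> \<subseteq> Q \<and> bsize \<phi> \<le> n * (4 * card Q + 5) + 1 \<and>
    (\<forall>v. beval v \<phi> = (\<forall>t<n. \<not> ((\<exists>q\<in>Q. P t q \<and> v q) \<and> (\<exists>q\<in>Q. P' t q \<and> v q))))"
proof (induction n)
  case 0
  show ?case by (intro exI[of _ BTrue]) simp
next
  case (Suc n)
  then obtain \<phi> where \<phi>: "bvars \<phi> \<subseteq> Q" "bsize \<phi> \<le> n * (4 * card Q + 5) + 1"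
    "\<forall>v. beval v \<phi> = (\<forall>t<n. \<not> ((\<exists>q\<in>Q. P t q \<and> v q) \<and> (\<exists>q\<in>Q. P' t q \<and> v q)))" by blast
  obtain \<psi> where \<psi>: "bvars \<psi> \<subseteq> Q \<and> bsize \<psi> \<le> 2 * card Q + 1 \<and>
    (\<forall>v. beval v \<psi> = (\<exists>q\<in>Q. P n q \<and> v q))"
    by (rule exE[OF disjunction_formula[OF assms, of "P n"]])
  obtain \<psi>' where \<psi>': "bvars \<psi>' \<subseteq> Q \<and> bsize \<psi>' \<le> 2 * card Q + 1 \<and>
    (\<forall>v. beval v \<psi>' = (\<exists>q\<in>Q. P' n q \<and> v q))"
    by (rule exE[OF disjunction_formula[OF assms, of "P' n"]])
  define \<chi> where "\<chi> = BAnd (BNot (BAnd \<psi> \<psi>')) \<phi>"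
  have "bvars \<chi> \<subseteq> Q" using \<phi> \<psi> \<psi>' by (simp add: \<chi>_def)
  moreover have "bsize \<chi> \<le> Suc n * (4 * card Q + 5) + 1" using \<phi> \<psi> \<psi>' by (simp add: \<chi>_def)
  moreover have "beval v \<chi> =
      (\<forall>t<Suc n. \<not> ((\<exists>q\<in>Q. P t q \<and> v q) \<and> (\<exists>q\<in>Q. P' t q \<and> v q)))" for v
    unfolding \<chi>_def beval.simps All_less_Suc using \<phi>(3) \<psi> \<psi>' by presburger
  ultimately show ?case by blast
qed

section \<open>Transport along an injection of the states into the naturals\<close>

lemma beval_map_bform: "beval v (map_bform h \<phi>) = beval (\<lambda>q. v (h q)) \<phi>"
  by (induction \<phi>) auto

lemma bsize_map_bform: "bsize (map_bform h \<phi>) = bsize \<phi>"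
  by (induction \<phi>) auto

lemma bvars_map_bform: "bvars (map_bform h \<phi>) = h ` bvars \<phi>"
  by (induction \<phi>) auto

lemma beval_cong: "(\<And>q. q \<in> bvars \<phi> \<Longrightarrow> v q = v' q) \<Longrightarrow> beval v \<phi> = beval v' \<phi>"
  by (induction \<phi>) auto

text \<open>The theorem fixes \<open>nat\<close> as the state type. All variables of
  \<open>\<phi>\<close> lie in \<open>Q\<close>, where the renaming is injective, so the renamed
  formula evaluates alike on the renamed run.\<close>

lemma nat_automaton:
  fixes Q :: "'q set" and \<Delta> :: "('q \<times> 'a \<times> 'q) set"
  assumes "finite Q" "finite S" "q0 \<in> Q" "\<Delta> \<subseteq> Q \<times> S \<times> Q" "bvars \<phi> \<subseteq> Q"
  shows "\<exists>A :: (nat, 'a) wm_aut. wf_wm A \<and> alph A = S \<and> wm_size A = card Q + bsize \<phi> \<and>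
    wm_lang A = {w. \<exists>\<rho>. \<rho> 0 = q0 \<and> (\<forall>i. (\<rho> i, w i, \<rho> (Suc i)) \<in> \<Delta>) \<and> beval (\<lambda>q. q \<in> range \<rho>) \<phi>}"
proof -
  obtain h :: "'q \<Rightarrow> nat" where h: "inj_on h Q"
    using finite_imp_inj_to_nat_seg[OF assms(1)] by blast
  define A :: "(nat, 'a) wm_aut" where "A = \<lparr>states = h ` Q, alph = S, init = h q0,
    trans = (\<lambda>(p, a, q). (h p, a, h q)) ` \<Delta>, accf = map_bform h \<phi>\<rparr>"
  have acc: "beval (\<lambda>q. q \<in> range (\<lambda>i. h (\<rho> i))) (map_bform h \<phi>) = beval (\<lambda>q. q \<in> range \<rho>) \<phi>"
    if "\<And>i. \<rho> i \<in> Q" for \<rho> :: "nat \<Rightarrow> 'q"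
    unfolding beval_map_bform
  proof (rule beval_cong)
    fix q assume "q \<in> bvars \<phi>"
    then have "q \<in> Q" using assms(5) by blast
    then show "(h q \<in> range (\<lambda>i. h (\<rho> i))) = (q \<in> range \<rho>)"
      using that inj_onD[OF h] by fastforce
  qed
  have "w \<in> wm_lang A \<longleftrightarrow>
      (\<exists>\<rho>. \<rho> 0 = q0 \<and> (\<forall>i. (\<rho> i, w i, \<rho> (Suc i)) \<in> \<Delta>) \<and> beval (\<lambda>q. q \<in> range \<rho>) \<phi>)" for w
  proof
    assume "w \<in> wm_lang A"
    then obtain \<sigma> where \<sigma>: "\<sigma> 0 = h q0" "\<And>i. (\<sigma> i, w i, \<sigma> (Suc i)) \<in> trans A"
      "beval (\<lambda>q. q \<in> range \<sigma>) (map_bform h \<phi>)"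
      by (auto simp: wm_lang_def wm_accepting_run_def A_def)
    define \<rho> where "\<rho> i = inv_into Q h (\<sigma> i)" for i
    have tr: "\<rho> i \<in> Q \<and> \<sigma> i = h (\<rho> i) \<and> (\<rho> i, w i, \<rho> (Suc i)) \<in> \<Delta>" for i
    proof -
      obtain p q where pq: "(p, w i, q) \<in> \<Delta>" "\<sigma> i = h p" "\<sigma> (Suc i) = h q"
        using \<sigma>(2)[of i] by (auto simp: A_def)
      then have "p \<in> Q" "q \<in> Q" using assms(4) by auto
      then show ?thesis using pq h by (simp add: \<rho>_def)
    qed
    have "\<sigma> = (\<lambda>i. h (\<rho> i))" using tr by auto
    then have "beval (\<lambda>q. q \<in> range \<rho>) \<phi>" using acc[of \<rho>] \<sigma>(3) tr by simp
    moreover have "\<rho> 0 = q0" using \<sigma>(1) assms(3) h by (simp add: \<rho>_def)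
    ultimately show "\<exists>\<rho>. \<rho> 0 = q0 \<and> (\<forall>i. (\<rho> i, w i, \<rho> (Suc i)) \<in> \<Delta>) \<and> beval (\<lambda>q. q \<in> range \<rho>) \<phi>"
      using tr by blast
  next
    assume "\<exists>\<rho>. \<rho> 0 = q0 \<and> (\<forall>i. (\<rho> i, w i, \<rho> (Suc i)) \<in> \<Delta>) \<and> beval (\<lambda>q. q \<in> range \<rho>) \<phi>"
    then obtain \<rho> where \<rho>: "\<rho> 0 = q0" "\<And>i. (\<rho> i, w i, \<rho> (Suc i)) \<in> \<Delta>"
      "beval (\<lambda>q. q \<in> range \<rho>) \<phi>" by blast
    have "\<rho> i \<in> Q" for i using \<rho>(2)[of i] assms(4) by auto
    then have "wm_accepting_run A w (\<lambda>i. h (\<rho> i))"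
      using \<rho> acc[of \<rho>] by (force simp: wm_accepting_run_def A_def)
    then show "w \<in> wm_lang A" by (auto simp: wm_lang_def)
  qed
  moreover have "wf_wm A"
    using assms by (fastforce simp: wf_wm_def A_def bvars_map_bform)
  moreover have "wm_size A = card Q + bsize \<phi>"
    using card_image[OF h] by (simp add: wm_size_def A_def bsize_map_bform)
  ultimately show ?thesis
    by (intro exI[of _ A]) (auto simp: A_def)
qed

section \<open>The automaton\<close>

text \<open>
  Phases: 0 first slot, 1 rest of block 0, 2 before block \<open>p\<close>, 3 before the end of block \<open>q\<close>,
  4 waiting for a challenge, 5 reading it. \<open>guess\<close> is the guessed bit number \<open>ofs - 1\<close> of the address
  \<open>k\<close>; \<open>flag\<close>: all data bits of O in this block were set so far; \<open>jbit\<close>: bit \<open>k\<close> of \<open>j\<close>; \<open>prv\<close>, \<open>cur\<close>: the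
  address of the previous (current, as far as read) slot is \<open>k\<close>; \<open>carry\<close>, \<open>ones\<close>: the bits of \<open>k\<close>
  (of the current address) read so far are all 1; \<open>ok\<close>: no check has failed.
\<close>

datatype st = St (phase: nat) (ofs: nat) (guess: bool) (flag: bool) (jbit: bool) (prv: bool)
  (cur: bool) (carry: bool) (ones: bool) (ok: bool)

text \<open>The parameter \<open>g\<close> is the nondeterministic guess; letter 2 of Player I starts a challenge.\<close>

fun step :: "nat \<Rightarrow> bool \<Rightarrow> st \<Rightarrow> nat \<times> nat \<Rightarrow> st" where
  "step n g (St ph t b fl j pe e c ao k) (x, y) =
    (if ph < 4 then
       if t < n then
         St ph (Suc t) g fl j pe (e \<and> (y = 1) = g) (c \<and> g) (ao \<and> y = 1)
           (k \<and> (pe \<longrightarrow> (y = 1) = (g \<noteq> c)) \<and> (ph = 0 \<longrightarrow> y \<noteq> 1))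
       else
         St (if ph = 0 then 1 else if ao \<and> (ph = 1 \<or> fl \<and> y = 1) then Suc ph else ph) 0 False
           (ao \<or> fl \<and> y = 1) (if ph \<le> 1 \<and> e then y = 1 else j) e True True True
           (k \<and> (2 \<le> ph \<and> fl \<and> e \<longrightarrow> (if y = 1 then (x = 1) = j else ph = 3 \<longrightarrow> x \<noteq> 1 \<and> j)))
     else if ph = 4 then
       if x = 2 then St 5 0 False fl j pe e c ao k else St ph t b fl j pe e c ao k
     else if t < n then St ph (Suc t) g fl j pe e c ao (k \<and> (x = 1) = g)
     else St ph t b fl j pe e c ao k)"

lemma step_simps:
  "ph < 4 \<Longrightarrow> t < n \<Longrightarrow> step n g (St ph t b fl j pe e c ao k) (x, y) =
    St ph (Suc t) g fl j pe (e \<and> (y = 1) = g) (c \<and> g) (ao \<and> y = 1)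
      (k \<and> (pe \<longrightarrow> (y = 1) = (g \<noteq> c)) \<and> (ph = 0 \<longrightarrow> y \<noteq> 1))"
  "ph < 4 \<Longrightarrow> n \<le> t \<Longrightarrow> step n g (St ph t b fl j pe e c ao k) (x, y) =
    St (if ph = 0 then 1 else if ao \<and> (ph = 1 \<or> fl \<and> y = 1) then Suc ph else ph) 0 False
      (ao \<or> fl \<and> y = 1) (if ph \<le> 1 \<and> e then y = 1 else j) e True True True
      (k \<and> (2 \<le> ph \<and> fl \<and> e \<longrightarrow> (if y = 1 then (x = 1) = j else ph = 3 \<longrightarrow> x \<noteq> 1 \<and> j)))"
  "x \<noteq> 2 \<Longrightarrow> step n g (St 4 t b fl j pe e c ao k) (x, y) = St 4 t b fl j pe e c ao k"
  "step n g (St 4 t b fl j pe e c ao k) (2, y) = St 5 0 False fl j pe e c ao k"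
  "4 < ph \<Longrightarrow> t < n \<Longrightarrow> step n g (St ph t b fl j pe e c ao k) (x, y) =
    St ph (Suc t) g fl j pe e c ao (k \<and> (x = 1) = g)"
  "4 < ph \<Longrightarrow> n \<le> t \<Longrightarrow> step n g (St ph t b fl j pe e c ao k) (x, y) = St ph t b fl j pe e c ao k"
  by simp_all

declare step.simps [simp del]

lemma st_letter_cases:
  obtains (addr) ph t b fl j pe e c ao k x y where "q = St ph t b fl j pe e c ao k" "l = (x, y)" "ph < 4" "t < n"
  | (data) ph t b fl j pe e c ao k x y where "q = St ph t b fl j pe e c ao k" "l = (x, y)" "ph < 4" "n \<le> t"
  | (wait) t b fl j pe e c ao k x y where "q = St 4 t b fl j pe e c ao k" "l = (x, y)" "x \<noteq> 2"
  | (start) t b fl j pe e c ao k y where "q = St 4 t b fl j pe e c ao k" "l = (2, y)"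
  | (chal) ph t b fl j pe e c ao k x y where "q = St ph t b fl j pe e c ao k" "l = (x, y)" "4 < ph" "t < n"
  | (rest) ph t b fl j pe e c ao k x y where "q = St ph t b fl j pe e c ao k" "l = (x, y)" "4 < ph" "n \<le> t"
proof -
  obtain ph t b fl j pe e c ao k where q: "q = St ph t b fl j pe e c ao k" by (cases q)
  obtain x y where l: "l = (x, y)" by (cases l)
  consider "ph < 4" "t < n" | "ph < 4" "n \<le> t" | "ph = 4" "x \<noteq> 2" | "ph = 4" "x = 2"
    | "4 < ph" "t < n" | "4 < ph" "n \<le> t" by linarith
  then show thesis
  proof cases
    case 1 with q l show ?thesis by (rule addr)
  next
    case 2 with q l show ?thesis by (rule data)
  next
    case 3 with q l show ?thesis using wait by simp
  next
    case 4 with q l show ?thesis using start by simp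
  next
    case 5 with q l show ?thesis by (rule chal)
  next
    case 6 with q l show ?thesis by (rule rest)
  qed
qed

text \<open>\<open>prv\<close> is False because no slot precedes the first; \<open>cur\<close>,
  \<open>carry\<close> and \<open>ones\<close> are conjunctions over the bits read so far, hence
  True.\<close>

definition st0 :: st where
  "st0 = St 0 0 False True False False True True True True"

definition stset :: "nat \<Rightarrow> st set" where
  "stset n = {q. phase q \<le> 5 \<and> ofs q \<le> n}"

text \<open>The run in which all guesses are read off one fixed \<open>\<kappa>\<close>; the
  nondeterminism is thereby reduced to the choice of \<open>\<kappa>\<close>.\<close>

primrec gorun :: "nat \<Rightarrow> (nat \<Rightarrow> bool) \<Rightarrow> (nat \<Rightarrow> nat \<times> nat) \<Rightarrow> nat \<Rightarrow> st" where
  "gorun n \<kappa> w 0 = st0"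
| "gorun n \<kappa> w (Suc i) = step n (\<kappa> (ofs (gorun n \<kappa> w i))) (gorun n \<kappa> w i) (w i)"

lemma finite_stset: "finite (stset n)" and card_stset: "card (stset n) \<le> 1536 * Suc n"
proof -
  define S where "S = {..5::nat} \<times> {..n} \<times> (UNIV :: (bool \<times> bool \<times> bool \<times> bool \<times> bool \<times> bool \<times> bool \<times> bool) set)"
  define h where "h = (\<lambda>(p, t, b, fl, j, pe, e, c, ao, k). St p t b fl j pe e c ao k)"
  have sub: "stset n \<subseteq> h ` S"
  proof
    fix q assume q: "q \<in> stset n"
    have "q = h (phase q, ofs q, guess q, flag q, jbit q, prv q, cur q, carry q, ones q, ok q)"
      by (simp add: h_def)
    then show "q \<in> h ` S"
      by (rule image_eqI) (use q in \<open>simp add: stset_def S_def\<close>)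
  qed
  have fin: "finite S" by (simp add: S_def)
  \<comment> \<open>Six phases times \<open>2 ^ 8\<close> values of the eight Boolean fields;
    \<open>Suc n\<close> counts the offsets.\<close>
  have "card S = 1536 * Suc n"
    by (simp add: S_def card_cartesian_product flip: UNIV_Times_UNIV)
  then show "card (stset n) \<le> 1536 * Suc n"
    using card_mono[OF finite_imageI[OF fin] sub] card_image_le[OF fin, of h] by linarith
  show "finite (stset n)" using sub fin finite_subset by blast
qed

lemma step_in_stset: "q \<in> stset n \<Longrightarrow> step n g q l \<in> stset n"
  by (rule st_letter_cases[of q l n]) (simp_all add: step_simps stset_def)

lemma gorun_in_stset: "gorun n \<kappa> w i \<in> stset n"
proof (induction i)
  case 0
  show ?case by (simp add: st0_def stset_def)
qed (simp add: step_in_stset)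

text \<open>A letter either consumes a guess, which the next state stores, or acts independently of
  the guess and resets the offset or keeps the state. Hence a state with positive offset stores the
  guess of the bit just before it.\<close>

lemma step_cases:
  obtains "ofs (step n g q l) = Suc (ofs q)" "guess (step n g q l) = g" "ofs q < n"
  | "\<And>g'. step n g' q l = step n g q l" "ofs (step n g q l) = 0 \<or> step n g q l = q"
  by (rule st_letter_cases[of q l n]) (simp_all add: step_simps)

lemma guess_gorun: "ofs (gorun n \<kappa> w i) = Suc t \<Longrightarrow> t < n \<and> guess (gorun n \<kappa> w i) = \<kappa> t"
proof (induction i)
  case (Suc i)
  show ?case
    by (rule step_cases[of n "\<kappa> (ofs (gorun n \<kappa> w i))" "gorun n \<kappa> w i" "w i"]) (use Suc in auto)
qed (simp add: st0_def)

text \<open>The acceptance condition forces all guesses of the same bit to agree, so every accepting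
  run is \<open>gorun\<close> for a single \<open>\<kappa>\<close>.\<close>

lemma automaton_exists:
  assumes "finite S"
  shows "\<exists>A :: (nat, nat \<times> nat) wm_aut. wf_wm A \<and> alph A = S \<and>
    wm_size A \<le> 6 * (1536 * Suc n) * Suc n + 7 * n + 20 \<and>
    wm_lang A = {w. (\<forall>i. w i \<in> S) \<and>
      (\<exists>\<kappa>. (\<exists>i. 4 \<le> phase (gorun n \<kappa> w i)) \<and> (\<forall>i. ok (gorun n \<kappa> w i)))}"
proof -
  let ?Q = "stset n"
  obtain \<phi>1 where \<phi>1: "bvars \<phi>1 \<subseteq> ?Q" "bsize \<phi>1 \<le> 2 * card ?Q + 1"
    "\<And>v. beval v \<phi>1 = (\<exists>q\<in>?Q. 4 \<le> phase q \<and> v q)"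
    using disjunction_formula[OF finite_stset, of n "\<lambda>q. 4 \<le> phase q"] by metis
  obtain \<phi>2 where \<phi>2: "bvars \<phi>2 \<subseteq> ?Q" "bsize \<phi>2 \<le> 2 * card ?Q + 1"
    "\<And>v. beval v \<phi>2 = (\<exists>q\<in>?Q. \<not> ok q \<and> v q)"
    using disjunction_formula[OF finite_stset, where P = "\<lambda>q. \<not> ok q"] by metis
  obtain \<phi>3 where \<phi>3_all: "bvars \<phi>3 \<subseteq> ?Q \<and> bsize \<phi>3 \<le> n * (4 * card ?Q + 5) + 1 \<and>
      (\<forall>v. beval v \<phi>3 = (\<forall>t<n. \<not> ((\<exists>q\<in>?Q. (ofs q = Suc t \<and> guess q) \<and> v q) \<and>
        (\<exists>q\<in>?Q. (ofs q = Suc t \<and> \<not> guess q) \<and> v q))))"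
    by (rule exE[OF exclusion_formula[OF finite_stset, where P = "\<lambda>t q. ofs q = Suc t \<and> guess q"
        and P' = "\<lambda>t q. ofs q = Suc t \<and> \<not> guess q"]])
  then have \<phi>3: "bvars \<phi>3 \<subseteq> ?Q" "bsize \<phi>3 \<le> n * (4 * card ?Q + 5) + 1" by auto
  note \<phi>3_eval = \<phi>3_all[THEN conjunct2, THEN conjunct2, rule_format]
  \<comment> \<open>The conjuncts say that phase 4 is reached, that no check fails, and that no bit
    is guessed in both ways.\<close>
  define \<phi> where "\<phi> = BAnd \<phi>1 (BAnd (BNot \<phi>2) \<phi>3)"
  define \<Delta> where "\<Delta> = {(q, l, step n g q l) | q l g. q \<in> ?Q \<and> l \<in> S}"
  have "st0 \<in> ?Q" by (simp add: st0_def stset_def)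
  moreover have "\<Delta> \<subseteq> ?Q \<times> S \<times> ?Q" by (auto simp: \<Delta>_def step_in_stset)
  moreover have "bvars \<phi> \<subseteq> ?Q" using \<phi>1 \<phi>2 \<phi>3 by (simp add: \<phi>_def)
  ultimately obtain A :: "(nat, nat \<times> nat) wm_aut" where A: "wf_wm A" "alph A = S" "wm_size A = card ?Q + bsize \<phi>"
    "wm_lang A = {w. \<exists>\<rho>. \<rho> 0 = st0 \<and> (\<forall>i. (\<rho> i, w i, \<rho> (Suc i)) \<in> \<Delta>) \<and> beval (\<lambda>q. q \<in> range \<rho>) \<phi>}"
    using nat_automaton[OF finite_stset assms, of st0 n \<Delta> \<phi>] by auto
  have "wm_size A \<le> card ?Q + (2 + (2 * card ?Q + 1) + 1 + (2 * card ?Q + 1) + n * (4 * card ?Q + 5) + 1)"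
    using A \<phi>1 \<phi>2 \<phi>3 by (simp add: \<phi>_def)
  also have "\<dots> \<le> 6 * card ?Q * Suc n + 7 * n + 20"
    by (simp add: algebra_simps)
  also have "\<dots> \<le> 6 * (1536 * Suc n) * Suc n + 7 * n + 20"
    using card_stset[of n] by (intro add_mono mult_mono) auto
  finally have size: "wm_size A \<le> 6 * (1536 * Suc n) * Suc n + 7 * n + 20" .
  have "(\<exists>\<rho>. \<rho> 0 = st0 \<and> (\<forall>i. (\<rho> i, w i, \<rho> (Suc i)) \<in> \<Delta>) \<and> beval (\<lambda>q. q \<in> range \<rho>) \<phi>) \<longleftrightarrow>
    (\<forall>i. w i \<in> S) \<and> (\<exists>\<kappa>. (\<exists>i. 4 \<le> phase (gorun n \<kappa> w i)) \<and> (\<forall>i. ok (gorun n \<kappa> w i)))" (is "?L \<longleftrightarrow> ?R") for w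
  proof
    assume ?L
    then obtain \<rho> where \<rho>: "\<rho> 0 = st0" "\<And>i. (\<rho> i, w i, \<rho> (Suc i)) \<in> \<Delta>" "beval (\<lambda>q. q \<in> range \<rho>) \<phi>"
      by blast
    have inQ: "\<rho> i \<in> ?Q" for i using \<rho>(2)[of i] by (auto simp: \<Delta>_def)
    \<comment> \<open>\<open>\<kappa>\<close> collects the bits that the run guesses as set; a bit
      that is never guessed becomes False. By \<open>\<phi>3\<close> every guess of bit
      \<open>t\<close> equals \<open>\<kappa> t\<close>.\<close>
    define \<kappa> where "\<kappa> t = (\<exists>i. ofs (\<rho> i) = Suc t \<and> guess (\<rho> i))" for t
    have \<kappa>: "guess (\<rho> i) = \<kappa> t" if "ofs (\<rho> i) = Suc t" "t < n" for i t
    proof (cases "guess (\<rho> i)")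
      case False
      have "beval (\<lambda>q. q \<in> range \<rho>) \<phi>3" using \<rho>(3) by (simp add: \<phi>_def)
      note this[unfolded \<phi>3_eval, rule_format, OF that(2)]
      then have "\<not> \<kappa> t" using False that inQ unfolding \<kappa>_def by blast
      then show ?thesis using False by simp
    qed (use that in \<open>auto simp: \<kappa>_def\<close>)
    have run: "\<rho> i = gorun n \<kappa> w i" for i
    proof (induction i)
      case (Suc i)
      obtain g where g: "\<rho> (Suc i) = step n g (\<rho> i) (w i)"
        using \<rho>(2)[of i] by (auto simp: \<Delta>_def)
      have "step n g (\<rho> i) (w i) = step n (\<kappa> (ofs (\<rho> i))) (\<rho> i) (w i)"
      proof (rule step_cases[of n g "\<rho> i" "w i"])
        assume "ofs (step n g (\<rho> i) (w i)) = Suc (ofs (\<rho> i))" "guess (step n g (\<rho> i) (w i)) = g" "ofs (\<rho> i) < n"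
        then show ?thesis using \<kappa>[of "Suc i"] g by simp
      qed metis
      then show ?case using Suc g by simp
    qed (simp add: \<rho>)
    have "w i \<in> S" for i using \<rho>(2)[of i] by (auto simp: \<Delta>_def)
    moreover have "\<exists>i. 4 \<le> phase (\<rho> i)"
      using \<rho>(3) by (auto simp: \<phi>_def \<phi>1(3))
    moreover have "ok (\<rho> i)" for i
      using \<rho>(3) inQ[of i] by (auto simp: \<phi>_def \<phi>2(3))
    ultimately show ?R using run by auto
  next
    assume ?R
    then obtain \<kappa> where \<kappa>: "\<And>i. w i \<in> S" "\<exists>i. 4 \<le> phase (gorun n \<kappa> w i)" "\<And>i. ok (gorun n \<kappa> w i)"
      by blast
    have "(gorun n \<kappa> w i, w i, gorun n \<kappa> w (Suc i)) \<in> \<Delta>" for i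
      using gorun_in_stset \<kappa>(1) unfolding \<Delta>_def gorun.simps by blast
    moreover have "beval (\<lambda>q. q \<in> range (gorun n \<kappa> w)) \<phi>1"
      using \<kappa>(2) gorun_in_stset by (auto simp: \<phi>1(3))
    moreover have "\<not> beval (\<lambda>q. q \<in> range (gorun n \<kappa> w)) \<phi>2"
      using \<kappa>(3) by (auto simp: \<phi>2(3))
    moreover have "beval (\<lambda>q. q \<in> range (gorun n \<kappa> w)) \<phi>3"
      using guess_gorun[of n \<kappa> w] unfolding \<phi>3_eval by blast
    ultimately show ?L
      by (intro exI[of _ "gorun n \<kappa> w"]) (auto simp: \<phi>_def)
  qed
  then show ?thesis using A size by (intro exI[of _ A]) auto
qed

section \<open>The behaviour of the automaton slot by slot\<close>

definition pos :: "nat \<Rightarrow> nat \<Rightarrow> nat \<Rightarrow> nat" where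
  "pos n s t = s * Suc n + t"

lemma pos_Suc: "pos n s (Suc t) = Suc (pos n s t)"
  and pos_next: "pos n (Suc s) 0 = Suc (pos n s n)"
  and pos_00: "pos n 0 0 = 0"
  by (simp_all add: pos_def)

lemma pos_div_mod: "pos n (i div Suc n) (i mod Suc n) = i"
  unfolding pos_def by (rule div_mult_mod_eq)

lemma pos_div: "t \<le> n \<Longrightarrow> pos n s t div Suc n = s"
  and pos_mod: "t \<le> n \<Longrightarrow> pos n s t mod Suc n = t"
  unfolding pos_def by (simp_all only: mod_mult_self3 div_mult_self3) simp_all

lemma pos_less: "s < s' \<Longrightarrow> t \<le> n \<Longrightarrow> pos n s t < pos n s' 0"
proof -
  assume "s < s'" "t \<le> n"
  then have "pos n s t < Suc s * Suc n" by (simp add: pos_def)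
  also have "\<dots> \<le> s' * Suc n" using \<open>s < s'\<close> by (intro mult_le_mono1) simp
  finally show ?thesis by (simp add: pos_def)
qed

lemma pos_mono: "s \<le> s' \<Longrightarrow> pos n s 0 \<le> pos n s' 0"
  unfolding pos_def by (simp add: mult_le_mono1 add_mono)

definition hit :: "nat \<Rightarrow> (nat \<Rightarrow> bool) \<Rightarrow> (nat \<Rightarrow> bool) \<Rightarrow> nat \<Rightarrow> bool" where
  "hit n \<beta> \<kappa> s = (\<forall>u<n. \<beta> (pos n s u) = \<kappa> u)"

definition full :: "nat \<Rightarrow> (nat \<Rightarrow> bool) \<Rightarrow> nat \<Rightarrow> bool" where
  "full n \<beta> s = (\<forall>u<n. \<beta> (pos n s u))"

definition dat :: "nat \<Rightarrow> (nat \<Rightarrow> bool) \<Rightarrow> nat \<Rightarrow> bool" where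
  "dat n \<beta> s = \<beta> (pos n s n)"

text \<open>The phase and the flag before slot \<open>s\<close> depend on the letters of Player O only.\<close>

fun ctl :: "nat \<Rightarrow> (nat \<Rightarrow> bool) \<Rightarrow> nat \<Rightarrow> nat \<times> bool" where
  "ctl n \<beta> 0 = (0, True)"
| "ctl n \<beta> (Suc s) = (let p = fst (ctl n \<beta> s); f = snd (ctl n \<beta> s) \<and> dat n \<beta> s in
    (if p = 0 then 1 else if full n \<beta> s \<and> (p = 1 \<or> f) then Suc p else p, full n \<beta> s \<or> f))"

text \<open>The content of \<open>jbit\<close> before slot \<open>s\<close>. Phases 0 and 1 make up
  block 0, so the bit of \<open>j\<close> at the guessed address is stored there and frozen
  afterwards.\<close>

fun jval :: "nat \<Rightarrow> (nat \<Rightarrow> bool) \<Rightarrow> (nat \<Rightarrow> bool) \<Rightarrow> nat \<Rightarrow> bool" where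
  "jval n \<beta> \<kappa> 0 = False"
| "jval n \<beta> \<kappa> (Suc s) =
    (if fst (ctl n \<beta> s) \<le> 1 \<and> hit n \<beta> \<kappa> s then dat n \<beta> s else jval n \<beta> \<kappa> s)"

text \<open>What the run with guess \<open>\<kappa>\<close> verifies in slot \<open>s\<close>. An
  increment is checked only after a slot with the guessed address, so the whole address sequence is
  verified only by all \<open>\<kappa>\<close> together. A missing mark is constrained in phase 3
  only, since blocks before \<open>p\<close> need not be below \<open>j\<close>.\<close>

definition chk :: "nat \<Rightarrow> (nat \<Rightarrow> bool) \<Rightarrow> (nat \<Rightarrow> bool) \<Rightarrow> (nat \<Rightarrow> bool) \<Rightarrow> nat \<Rightarrow> bool" where
  "chk n \<beta> x \<kappa> s \<longleftrightarrow>
    (0 < s \<and> hit n \<beta> \<kappa> (s - 1) \<longrightarrow> (\<forall>u<n. \<beta> (pos n s u) = incr \<kappa> u)) \<and>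
    (fst (ctl n \<beta> s) = 0 \<longrightarrow> (\<forall>u<n. \<not> \<beta> (pos n s u))) \<and>
    (2 \<le> fst (ctl n \<beta> s) \<and> snd (ctl n \<beta> s) \<and> hit n \<beta> \<kappa> s \<longrightarrow>
      (if dat n \<beta> s then x s = jval n \<beta> \<kappa> s else fst (ctl n \<beta> s) = 3 \<longrightarrow> \<not> x s \<and> jval n \<beta> \<kappa> s))"

abbreviation obit :: "(nat \<Rightarrow> nat \<times> nat) \<Rightarrow> nat \<Rightarrow> bool" where
  "obit w i \<equiv> snd (w i) = 1"

abbreviation idat :: "nat \<Rightarrow> (nat \<Rightarrow> nat \<times> nat) \<Rightarrow> nat \<Rightarrow> bool" where
  "idat n w s \<equiv> fst (w (pos n s n)) = 1"

text \<open>After a hit the previous address is \<open>\<kappa>\<close>, so the expected bit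
  \<open>incr \<kappa> t\<close> is computed from the current guess and \<open>carry\<close>; the
  previous address need not be stored.\<close>

lemma gorun_within_slot:
  assumes "gorun n \<kappa> w (pos n s 0) = St p 0 False f j pe True True True k" "p < 4" "t \<le> n"
  shows "gorun n \<kappa> w (pos n s t) = St p t (0 < t \<and> \<kappa> (t - 1)) f j pe
    (\<forall>u<t. obit w (pos n s u) = \<kappa> u) (\<forall>u<t. \<kappa> u) (\<forall>u<t. obit w (pos n s u))
    (k \<and> (pe \<longrightarrow> (\<forall>u<t. obit w (pos n s u) = incr \<kappa> u)) \<and> (p = 0 \<longrightarrow> (\<forall>u<t. \<not> obit w (pos n s u))))"
  using assms(3)
proof (induction t)
  case 0
  then show ?case using assms by simp
next
  case (Suc t)
  obtain x y where xy: "w (pos n s t) = (x, y)" by (cases "w (pos n s t)")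
  have t: "t < n" using Suc by simp
  let ?E = "\<lambda>t. \<forall>u<t. obit w (pos n s u) = \<kappa> u" and ?C = "\<lambda>t. \<forall>u<t. \<kappa> u"
  let ?A = "\<lambda>t. \<forall>u<t. obit w (pos n s u)" and ?I = "\<lambda>t. \<forall>u<t. obit w (pos n s u) = incr \<kappa> u"
  let ?Z = "\<lambda>t. \<forall>u<t. \<not> obit w (pos n s u)"
  have IH: "gorun n \<kappa> w (pos n s t) = St p t (0 < t \<and> \<kappa> (t - 1)) f j pe (?E t) (?C t) (?A t)
      (k \<and> (pe \<longrightarrow> ?I t) \<and> (p = 0 \<longrightarrow> ?Z t))" using Suc by simp
  have "gorun n \<kappa> w (pos n s (Suc t)) = St p (Suc t) (\<kappa> t) f j pe (?E t \<and> (y = 1) = \<kappa> t) (?C t \<and> \<kappa> t) (?A t \<and> y = 1)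
      ((k \<and> (pe \<longrightarrow> ?I t) \<and> (p = 0 \<longrightarrow> ?Z t)) \<and> (pe \<longrightarrow> (y = 1) = (\<kappa> t \<noteq> ?C t)) \<and> (p = 0 \<longrightarrow> y \<noteq> 1))"
    unfolding pos_Suc gorun.simps IH xy st.sel by (rule step_simps(1)[OF assms(2) t])
  moreover have "(?E t \<and> (y = 1) = \<kappa> t) = ?E (Suc t)" "(?C t \<and> \<kappa> t) = ?C (Suc t)" "(?A t \<and> y = 1) = ?A (Suc t)"
    unfolding All_less_Suc xy snd_conv by blast+
  moreover have "((k \<and> (pe \<longrightarrow> ?I t) \<and> (p = 0 \<longrightarrow> ?Z t)) \<and> (pe \<longrightarrow> (y = 1) = (\<kappa> t \<noteq> ?C t)) \<and> (p = 0 \<longrightarrow> y \<noteq> 1)) =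
      (k \<and> (pe \<longrightarrow> ?I (Suc t)) \<and> (p = 0 \<longrightarrow> ?Z (Suc t)))"
    unfolding All_less_Suc xy snd_conv incr_def[of \<kappa> t] by blast
  moreover have "\<kappa> t = (0 < Suc t \<and> \<kappa> (Suc t - 1))" by simp
  ultimately show ?case by (simp only:)
qed

text \<open>At a slot boundary only \<open>ok\<close> depends on the letters of Player I; it is the
  conjunction of the checks so far. The hypothesis keeps the automaton in the phases that read
  slots.\<close>

lemma gorun_slot:
  assumes "\<And>s'. s' < s \<Longrightarrow> fst (ctl n (obit w) s') < 4"
  shows "gorun n \<kappa> w (pos n s 0) = St (fst (ctl n (obit w) s)) 0 False (snd (ctl n (obit w) s))
    (jval n (obit w) \<kappa> s) (0 < s \<and> hit n (obit w) \<kappa> (s - 1)) True True True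
    (\<forall>s'<s. chk n (obit w) (idat n w) \<kappa> s')"
  using assms
proof (induction s)
  case 0
  show ?case by (simp add: pos_00 st0_def)
next
  case (Suc s)
  obtain x y where xy: "w (pos n s n) = (x, y)" by (cases "w (pos n s n)")
  let ?p = "fst (ctl n (obit w) s)"
  have p: "?p < 4" using Suc.prems by simp
  have "gorun n \<kappa> w (pos n s 0) = St ?p 0 False (snd (ctl n (obit w) s))
    (jval n (obit w) \<kappa> s) (0 < s \<and> hit n (obit w) \<kappa> (s - 1)) True True True
    (\<forall>s'<s. chk n (obit w) (idat n w) \<kappa> s')" using Suc by simp
  note slot_end = gorun_within_slot[OF this p order_refl]
  have dat: "dat n (obit w) s = (y = 1)" by (simp add: dat_def xy)
  have x: "idat n w s = (x = 1)" by (simp add: xy)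
  have "gorun n \<kappa> w (pos n (Suc s) 0) =
      St (if ?p = 0 then 1 else if full n (obit w) s \<and> (?p = 1 \<or> snd (ctl n (obit w) s) \<and> y = 1) then Suc ?p else ?p) 0 False
      (full n (obit w) s \<or> snd (ctl n (obit w) s) \<and> y = 1)
      (if ?p \<le> 1 \<and> hit n (obit w) \<kappa> s then y = 1 else jval n (obit w) \<kappa> s) (hit n (obit w) \<kappa> s) True True True
      (((\<forall>s'<s. chk n (obit w) (idat n w) \<kappa> s') \<and>
        (0 < s \<and> hit n (obit w) \<kappa> (s - 1) \<longrightarrow> (\<forall>u<n. obit w (pos n s u) = incr \<kappa> u)) \<and>
        (?p = 0 \<longrightarrow> (\<forall>u<n. \<not> obit w (pos n s u)))) \<and>
       (2 \<le> ?p \<and> snd (ctl n (obit w) s) \<and> hit n (obit w) \<kappa> s \<longrightarrow>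
        (if y = 1 then (x = 1) = jval n (obit w) \<kappa> s else ?p = 3 \<longrightarrow> x \<noteq> 1 \<and> jval n (obit w) \<kappa> s)))"
    unfolding pos_next gorun.simps slot_end xy st.sel full_def hit_def by (rule step_simps(2)[OF p order_refl])
  moreover have "((\<forall>s'<s. chk n (obit w) (idat n w) \<kappa> s') \<and>
        (0 < s \<and> hit n (obit w) \<kappa> (s - 1) \<longrightarrow> (\<forall>u<n. obit w (pos n s u) = incr \<kappa> u)) \<and>
        (?p = 0 \<longrightarrow> (\<forall>u<n. \<not> obit w (pos n s u)))) \<and>
       (2 \<le> ?p \<and> snd (ctl n (obit w) s) \<and> hit n (obit w) \<kappa> s \<longrightarrow>
        (if y = 1 then (x = 1) = jval n (obit w) \<kappa> s else ?p = 3 \<longrightarrow> x \<noteq> 1 \<and> jval n (obit w) \<kappa> s)) \<longleftrightarrow>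
      (\<forall>s'<Suc s. chk n (obit w) (idat n w) \<kappa> s')"
    unfolding All_less_Suc chk_def[of n "obit w" "idat n w" \<kappa> s] dat x by (simp only: conj_ac)
  ultimately show ?case
    by (simp only: ctl.simps jval.simps Let_def dat fst_conv snd_conv zero_less_Suc diff_Suc_1 simp_thms)
qed

lemma ok_step: "ok (step n g q l) \<Longrightarrow> ok q"
  by (rule st_letter_cases[of q l n]) (simp_all add: step_simps)

lemma ok_gorun_mono: "ok (gorun n \<kappa> w i) \<Longrightarrow> i' \<le> i \<Longrightarrow> ok (gorun n \<kappa> w i')"
proof (induction i)
  case (Suc i)
  then show ?case using ok_step by (cases "i' = Suc i") auto
qed simp

section \<open>Waiting for a challenge and reading it\<close>

definition first_chal :: "(nat \<Rightarrow> nat \<times> nat) \<Rightarrow> nat \<Rightarrow> nat \<Rightarrow> bool" where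
  "first_chal w Q P \<longleftrightarrow> Q \<le> P \<and> fst (w P) = 2 \<and> (\<forall>P'. Q \<le> P' \<and> P' < P \<longrightarrow> fst (w P') \<noteq> 2)"

lemma first_chal_exists:
  assumes "Q \<le> P" "fst (w P) = 2"
  shows "\<exists>P. first_chal w Q P"
proof -
  have "\<exists>P. Q \<le> P \<and> fst (w P) = 2" using assms by blast
  from exists_least_iff[THEN iffD1, OF this] show ?thesis
    unfolding first_chal_def by blast
qed

lemma gorun_wait:
  assumes "gorun n \<kappa> w Q = St 4 t b fl j pe e c ao k" "Q \<le> P" "\<And>P'. Q \<le> P' \<Longrightarrow> P' < P \<Longrightarrow> fst (w P') \<noteq> 2"
  shows "gorun n \<kappa> w P = St 4 t b fl j pe e c ao k"
  using assms(2,3)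
proof (induction P rule: dec_induct)
  case base
  show ?case by (rule assms(1))
next
  case (step P)
  obtain x y where xy: "w P = (x, y)" by (cases "w P")
  then have "x \<noteq> 2" using step by force
  then show ?case using step xy by (simp add: step_simps)
qed

lemma gorun_chal:
  assumes "gorun n \<kappa> w P = St 5 0 b fl j pe e c ao k" "t \<le> n"
  shows "\<exists>b'. gorun n \<kappa> w (P + t) = St 5 t b' fl j pe e c ao (k \<and> (\<forall>u<t. (fst (w (P + u)) = 1) = \<kappa> u))"
  using assms(2)
proof (induction t)
  case 0
  then show ?case using assms(1) by simp
next
  case (Suc t)
  obtain x y where xy: "w (P + t) = (x, y)" by (cases "w (P + t)")
  obtain b' where "gorun n \<kappa> w (P + t) = St 5 t b' fl j pe e c ao (k \<and> (\<forall>u<t. (fst (w (P + u)) = 1) = \<kappa> u))"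
    using Suc by auto
  then show ?case
    using Suc.prems xy by (auto simp: step_simps All_less_Suc)
qed

lemma gorun_rest:
  assumes "gorun n \<kappa> w P = St 5 n b fl j pe e c ao k"
  shows "gorun n \<kappa> w (P + i) = St 5 n b fl j pe e c ao k"
proof (induction i)
  case (Suc i)
  then show ?case by (cases "w (P + i)") (simp add: step_simps)
qed (simp add: assms)

lemma gorun_after_first_chal:
  assumes "gorun n \<kappa> w Q = St 4 0 False fl j pe e c ao k" "first_chal w Q P"
  shows "\<exists>b'. gorun n \<kappa> w (Suc P + n) = St 5 n b' fl j pe e c ao (k \<and> (\<forall>u<n. (fst (w (Suc P + u)) = 1) = \<kappa> u))"
proof (rule gorun_chal[OF _ order_refl])
  have "gorun n \<kappa> w P = St 4 0 False fl j pe e c ao k"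
    using assms by (intro gorun_wait[OF assms(1)]) (auto simp: first_chal_def)
  moreover have "w P = (2, snd (w P))" using assms(2) by (simp add: first_chal_def prod_eq_iff)
  ultimately show "gorun n \<kappa> w (Suc P) = St 5 0 False fl j pe e c ao k"
    by (metis gorun.simps(2) step_simps(4))
qed

text \<open>\<open>D\<close> is the last slot before phase 4. \<open>ok\<close> at the beginning of
  phase 4 yields the checks, and \<open>ok\<close> after the challenge yields its agreement with
  \<open>\<kappa>\<close>.\<close>

lemma accepted_slots:
  assumes "4 \<le> phase (gorun n \<kappa> w i)" "\<And>i. ok (gorun n \<kappa> w i)"
  obtains D where "fst (ctl n (obit w) (Suc D)) = 4" "\<And>s. s \<le> D \<Longrightarrow> fst (ctl n (obit w) s) < 4"
    "\<And>s. s \<le> D \<Longrightarrow> chk n (obit w) (idat n w) \<kappa> s"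
    "\<And>P u. first_chal w (pos n (Suc D) 0) P \<Longrightarrow> u < n \<Longrightarrow> (fst (w (Suc P + u)) = 1) = \<kappa> u"
proof -
  \<comment> \<open>Within a slot the phase is constant, so phase 4 has to show up at a slot
    boundary.\<close>
  have "\<exists>s. 4 \<le> fst (ctl n (obit w) s)"
  proof (rule ccontr)
    assume *: "\<nexists>s. 4 \<le> fst (ctl n (obit w) s)"
    let ?s = "i div Suc n" and ?t = "i mod Suc n"
    have lt: "fst (ctl n (obit w) s) < 4" for s using * not_le by blast
    have "?t \<le> n" using mod_less_divisor[of "Suc n" i] by linarith
    from gorun_within_slot[OF gorun_slot[of ?s n w \<kappa>, OF lt] lt this]
    have "phase (gorun n \<kappa> w (pos n ?s ?t)) < 4" using lt by simp
    then show False using assms(1) by (simp add: pos_div_mod)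
  qed
  then obtain s where s: "4 \<le> fst (ctl n (obit w) s)" and lt: "\<And>s'. s' < s \<Longrightarrow> fst (ctl n (obit w) s') < 4"
    using exists_least_iff[of "\<lambda>s. 4 \<le> fst (ctl n (obit w) s)"] by (auto simp: not_le)
  obtain D where D: "s = Suc D" using s by (cases s) auto
  have "fst (ctl n (obit w) (Suc D)) \<le> Suc (fst (ctl n (obit w) D))" by (simp add: Let_def)
  then have four: "fst (ctl n (obit w) (Suc D)) = 4" using s lt[of D] unfolding D by linarith
  have start: "gorun n \<kappa> w (pos n (Suc D) 0) = St 4 0 False (snd (ctl n (obit w) (Suc D)))
    (jval n (obit w) \<kappa> (Suc D)) (hit n (obit w) \<kappa> D) True True True
    (\<forall>s'<Suc D. chk n (obit w) (idat n w) \<kappa> s')"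
    using gorun_slot[of "Suc D" n w \<kappa>, OF lt[unfolded D]]
    by (simp only: four zero_less_Suc diff_Suc_1 simp_thms)
  have all: "\<forall>s'<Suc D. chk n (obit w) (idat n w) \<kappa> s'"
    using assms(2)[of "pos n (Suc D) 0"] unfolding start st.sel .
  show thesis
  proof (rule that[OF four])
    show "fst (ctl n (obit w) s) < 4" if "s \<le> D" for s using lt D that by simp
    show "chk n (obit w) (idat n w) \<kappa> s" if "s \<le> D" for s
      using all that le_imp_less_Suc by blast
    show "(fst (w (Suc P + u)) = 1) = \<kappa> u" if "first_chal w (pos n (Suc D) 0) P" "u < n" for P u
    proof -
      note chal = gorun_after_first_chal[OF start that(1)]
      obtain b' k where eq: "gorun n \<kappa> w (Suc P + n) = St 5 n b' (snd (ctl n (obit w) (Suc D)))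
        (jval n (obit w) \<kappa> (Suc D)) (hit n (obit w) \<kappa> D) True True True
        (k \<and> (\<forall>u<n. (fst (w (Suc P + u)) = 1) = \<kappa> u))"
        using chal by blast
      have "k \<and> (\<forall>u<n. (fst (w (Suc P + u)) = 1) = \<kappa> u)"
        using assms(2)[of "Suc P + n"] unfolding eq st.sel .
      then show ?thesis using that(2) by blast
    qed
  qed
qed

text \<open>Once lost, \<open>ok\<close> never returns, so it suffices to find it at arbitrarily
  late positions: after the challenge has been read or, if there is none, while waiting in phase
  4.\<close>

lemma slots_accepted:
  assumes "fst (ctl n (obit w) (Suc D)) = 4" "\<And>s. s \<le> D \<Longrightarrow> fst (ctl n (obit w) s) < 4"
    "\<And>s. s \<le> D \<Longrightarrow> chk n (obit w) (idat n w) \<kappa> s"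
    "\<And>P u. first_chal w (pos n (Suc D) 0) P \<Longrightarrow> u < n \<Longrightarrow> (fst (w (Suc P + u)) = 1) = \<kappa> u"
  shows "(\<exists>i. 4 \<le> phase (gorun n \<kappa> w i)) \<and> (\<forall>i. ok (gorun n \<kappa> w i))"
proof -
  let ?Q = "pos n (Suc D) 0"
  have start: "gorun n \<kappa> w ?Q = St 4 0 False (snd (ctl n (obit w) (Suc D)))
    (jval n (obit w) \<kappa> (Suc D)) (hit n (obit w) \<kappa> D) True True True True"
  proof -
    have "fst (ctl n (obit w) s) < 4" if "s < Suc D" for s
      using assms(2) that by (simp only: less_Suc_eq_le)
    note gorun_slot[of "Suc D", OF this, where \<kappa> = \<kappa>]
    moreover have "(\<forall>s'<Suc D. chk n (obit w) (idat n w) \<kappa> s') = True"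
      using assms(3) by (simp only: less_Suc_eq_le) blast
    ultimately show ?thesis
      by (simp only: assms(1) zero_less_Suc diff_Suc_1 simp_thms)
  qed
  have "ok (gorun n \<kappa> w i)" for i
  proof (cases "\<exists>P. first_chal w ?Q P")
    case True
    then obtain P where P: "first_chal w ?Q P" by blast
    obtain b where "gorun n \<kappa> w (Suc P + n) = St 5 n b (snd (ctl n (obit w) (Suc D)))
      (jval n (obit w) \<kappa> (Suc D)) (hit n (obit w) \<kappa> D) True True True True"
      using gorun_after_first_chal[OF start P] assms(4)[OF P] by auto
    from gorun_rest[OF this, of i] have "ok (gorun n \<kappa> w (Suc P + n + i))" by simp
    then show ?thesis by (rule ok_gorun_mono) simp
  next
    case False
    then have "fst (w P) \<noteq> 2" if "?Q \<le> P" for P using first_chal_exists that by blast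
    then have "gorun n \<kappa> w (?Q + i) = gorun n \<kappa> w ?Q"
      using gorun_wait[OF start, of "?Q + i"] start by simp
    then have "ok (gorun n \<kappa> w (?Q + i))" by (simp add: start)
    then show ?thesis by (rule ok_gorun_mono) simp
  qed
  moreover have "4 \<le> phase (gorun n \<kappa> w ?Q)" by (simp add: start)
  ultimately show ?thesis by blast
qed

section \<open>Blocks\<close>

lemma hit_iff: "hit n \<beta> \<kappa> s \<longleftrightarrow> bin n \<kappa> = bin n (\<lambda>t. \<beta> (pos n s t))"
  by (auto simp: hit_def bin_eq_iff)

lemma full_iff: "full n \<beta> s \<longleftrightarrow> bin n (\<lambda>t. \<beta> (pos n s t)) = 2 ^ n - 1"
  unfolding full_def bin_eq_max_iff ..

definition block_all :: "nat \<Rightarrow> (nat \<Rightarrow> bool) \<Rightarrow> nat \<Rightarrow> bool" where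
  "block_all n \<beta> b = (\<forall>a<2 ^ n. dat n \<beta> (b * 2 ^ n + a))"

text \<open>With \<open>1 \<le> n\<close> a block has at least two slots. Slot 0 always leads to
  phase 1, so block 0 needs a further slot in order to end in phase 2.\<close>

locale good_addresses =
  fixes n :: nat and \<beta> :: "nat \<Rightarrow> bool" and B :: nat
  assumes n: "1 \<le> n"
    and addr: "\<And>s. s < B \<Longrightarrow> bin n (\<lambda>t. \<beta> (pos n s t)) = s mod 2 ^ n"
begin

lemma two_le: "2 \<le> (2::nat) ^ n"
  using power_increasing[OF n, of "2::nat"] by simp

lemma full_addr: "s < B \<Longrightarrow> full n \<beta> s \<longleftrightarrow> s mod 2 ^ n = 2 ^ n - 1"
  by (simp add: full_iff addr)

lemma hit_addr: "s < B \<Longrightarrow> hit n \<beta> \<kappa> s \<longleftrightarrow> bin n \<kappa> = s mod 2 ^ n"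
  by (simp add: hit_iff addr)

lemma phase_block0: "0 < s \<Longrightarrow> s < 2 ^ n \<Longrightarrow> s \<le> B \<Longrightarrow> fst (ctl n \<beta> s) = 1"
proof (induction s)
  case (Suc s)
  show ?case
  proof (cases "s = 0")
    case False
    then have "fst (ctl n \<beta> s) = 1" using Suc by simp
    moreover have "\<not> full n \<beta> s" using full_addr[of s] Suc.prems by simp
    ultimately show ?thesis by (simp add: Let_def)
  qed (simp add: Let_def)
qed simp

lemma ctl_block1: 
  assumes "2 ^ n \<le> B"
  shows "ctl n \<beta> (2 ^ n) = (2, True)"
proof -
  obtain r :: nat where r: "2 ^ n = Suc r" using two_le by (cases "2 ^ n :: nat") auto
  have "fst (ctl n \<beta> r) = 1" using two_le assms r by (intro phase_block0) auto
  moreover have "full n \<beta> r" using full_addr[of r] assms r by simp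
  ultimately show ?thesis unfolding r ctl.simps Let_def by simp
qed

lemma ctl_within_block:
  assumes "ctl n \<beta> (b * 2 ^ n) = (p, True)" "2 \<le> p" "a < 2 ^ n" "b * 2 ^ n + a \<le> B"
  shows "ctl n \<beta> (b * 2 ^ n + a) = (p, \<forall>a'<a. dat n \<beta> (b * 2 ^ n + a'))"
  using assms(3,4)
proof (induction a)
  case (Suc a)
  have "\<not> full n \<beta> (b * 2 ^ n + a)" using full_addr[of "b * 2 ^ n + a"] Suc.prems by simp
  then show ?case using Suc assms(2) by (auto simp: Let_def All_less_Suc)
qed (simp add: assms)

text \<open>From block 1 on the phase rises exactly at the end of a fully marked block; the first
  two such blocks are the \<open>p\<close> and \<open>q\<close> of the claim.\<close>

lemma ctl_next_block:
  assumes "ctl n \<beta> (b * 2 ^ n) = (p, True)" "2 \<le> p" "Suc b * 2 ^ n \<le> B"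
  shows "ctl n \<beta> (Suc b * 2 ^ n) = (if block_all n \<beta> b then Suc p else p, True)"
proof -
  obtain r :: nat where r: "2 ^ n = Suc r" using two_le by (cases "2 ^ n :: nat") auto
  then have s: "Suc b * 2 ^ n = Suc (b * 2 ^ n + r)" by simp
  have le: "b * 2 ^ n + r < B" using assms(3) unfolding s by (rule Suc_le_lessD)
  have "ctl n \<beta> (b * 2 ^ n + r) = (p, \<forall>a'<r. dat n \<beta> (b * 2 ^ n + a'))"
    using assms le r by (intro ctl_within_block) auto
  moreover have "(b * 2 ^ n + r) mod 2 ^ n = r"
    using r by (metis lessI mod_less mod_mult_self3)
  then have "full n \<beta> (b * 2 ^ n + r)" using full_addr[OF le] r by simp
  moreover have "block_all n \<beta> b \<longleftrightarrow> (\<forall>a'<r. dat n \<beta> (b * 2 ^ n + a')) \<and> dat n \<beta> (b * 2 ^ n + r)"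
    unfolding block_all_def using r by (auto simp: less_Suc_eq)
  ultimately show ?thesis
    unfolding s ctl.simps Let_def using assms(2) by simp
qed

lemma phase_ge2: "2 ^ n \<le> s \<Longrightarrow> s \<le> B \<Longrightarrow> 2 \<le> fst (ctl n \<beta> s)"
proof (induction s rule: dec_induct)
  case base
  then show ?case using ctl_block1 by simp
next
  case (step s)
  then show ?case by (simp add: Let_def)
qed

lemma jval_block0: "s \<le> 2 ^ n \<Longrightarrow> s \<le> B \<Longrightarrow> jval n \<beta> \<kappa> s \<longleftrightarrow> bin n \<kappa> < s \<and> dat n \<beta> (bin n \<kappa>)"
proof (induction s)
  case (Suc s)
  have "fst (ctl n \<beta> s) \<le> 1" using phase_block0[of s] Suc.prems by (cases "s = 0") auto
  moreover have "hit n \<beta> \<kappa> s \<longleftrightarrow> bin n \<kappa> = s" using hit_addr[of s] Suc.prems by simp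
  ultimately show ?case using Suc by (auto simp: less_Suc_eq)
qed simp

text \<open>The slot with number \<open>bin n \<kappa>\<close> is the only one of block 0 with the
  guessed address, and from phase 2 on nothing is overwritten.\<close>

lemma jval_eq: "2 ^ n \<le> s \<Longrightarrow> s \<le> B \<Longrightarrow> jval n \<beta> \<kappa> s \<longleftrightarrow> dat n \<beta> (bin n \<kappa>)"
proof (induction s rule: dec_induct)
  case base
  then show ?case using jval_block0[of "2 ^ n" \<kappa>] bin_less[of n \<kappa>] by simp
next
  case (step s)
  then show ?case using phase_ge2[of s] by simp
qed

end

section \<open>Claims that pass all checks, and honest claims\<close>

lemma bin_eq_0_iff: "bin n f = 0 \<longleftrightarrow> (\<forall>t<n. \<not> f t)"
proof -
  have "bin n (\<lambda>_. False) = 0" by (induction n) auto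
  then show ?thesis using bin_eq_iff[of n f "\<lambda>_. False"] by auto
qed

text \<open>Soundness: the checks for all \<open>\<kappa>\<close> together make the addresses
  correct, the two fully marked blocks serve as \<open>p\<close> and \<open>q\<close>, and the first
  unmarked address of a block in between shows that it is below \<open>j\<close>.\<close>

lemma bad_pair_if_all_checks:
  assumes n: "1 \<le> n" and fin: "fst (ctl n \<beta> (Suc D)) = 4" and before: "\<And>s. s \<le> D \<Longrightarrow> fst (ctl n \<beta> s) < 4"
    and checks: "\<And>\<kappa> s. s \<le> D \<Longrightarrow> chk n \<beta> x \<kappa> s"
  obtains p q where "1 \<le> p" "p < q" "\<And>a. a < 2 ^ n \<Longrightarrow> x (p * 2 ^ n + a) = dat n \<beta> a"
    "\<And>a. a < 2 ^ n \<Longrightarrow> x (q * 2 ^ n + a) = dat n \<beta> a"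
    "\<And>b. p < b \<Longrightarrow> b < q \<Longrightarrow> val (2 ^ n) (\<lambda>a. x (b * 2 ^ n + a)) < val (2 ^ n) (dat n \<beta>)"
proof -
  let ?m = "2 ^ n :: nat"
  have "bin n (\<lambda>t. \<beta> (pos n s t)) = s mod ?m" if "s \<le> D" for s
    using that
  proof (induction s)
    case 0
    have "\<forall>u<n. \<not> \<beta> (pos n 0 u)" using checks[of 0] by (simp add: chk_def)
    then show ?case by (simp add: bin_eq_0_iff)
  next
    case (Suc s)
    \<comment> \<open>The guess is the address of slot \<open>s\<close> itself, so its increment is
      checked in slot \<open>Suc s\<close>.\<close>
    let ?\<kappa> = "\<lambda>t. \<beta> (pos n s t)"
    have "\<forall>u<n. \<beta> (pos n (Suc s) u) = incr ?\<kappa> u"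
      using checks[of "Suc s" ?\<kappa>] Suc.prems unfolding chk_def by (simp add: hit_def)
    then have "bin n (\<lambda>t. \<beta> (pos n (Suc s) t)) = bin n (incr ?\<kappa>)" by (simp add: bin_eq_iff)
    then show ?case using Suc by (simp add: bin_incr mod_Suc_eq)
  qed
  then interpret good_addresses n \<beta> "Suc D"
    using n by unfold_locales auto
  have "?m \<le> D"
  proof (rule ccontr)
    assume "\<not> ?m \<le> D"
    then consider "Suc D < ?m" | "Suc D = ?m" by linarith
    then show False
    proof cases
      case 1
      then have "fst (ctl n \<beta> (Suc D)) = 1" by (intro phase_block0) auto
      then show False using fin by linarith
    next
      case 2
      then have "fst (ctl n \<beta> (Suc D)) = 2" using ctl_block1 by (simp only: order_refl fst_conv)
      then show False using fin by linarith
    qed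
  qed
  \<comment> \<open>At block boundaries, either phase 2 still lasts, or \<open>p\<close> is the
    block that led to phase 3 and no block since then is fully marked.\<close>
  have inv: "ctl n \<beta> (b * ?m) = (2, True) \<or> ctl n \<beta> (b * ?m) = (3, True) \<and>
      (\<exists>p. 1 \<le> p \<and> p < b \<and> block_all n \<beta> p \<and> ctl n \<beta> (p * ?m) = (2, True) \<and>
        (\<forall>b'. p < b' \<and> b' < b \<longrightarrow> \<not> block_all n \<beta> b' \<and> ctl n \<beta> (b' * ?m) = (3, True)))"
    if "1 \<le> b" "b * ?m \<le> D" for b
    using that
  proof (induction b rule: dec_induct)
    case base
    then show ?case using ctl_block1 by simp
  next
    case (step b)
    have le: "Suc b * ?m \<le> Suc D" "b * ?m \<le> D" using step.prems by auto
    have lt4: "fst (ctl n \<beta> (Suc b * ?m)) < 4" using before step.prems by blast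
    from step.IH[OF le(2)] show ?case
    proof
      assume 2: "ctl n \<beta> (b * ?m) = (2, True)"
      then have "ctl n \<beta> (Suc b * ?m) = (if block_all n \<beta> b then Suc 2 else 2, True)"
        by (intro ctl_next_block le(1)) auto
      moreover have "\<forall>b'. b < b' \<and> b' < Suc b \<longrightarrow> \<not> block_all n \<beta> b' \<and> ctl n \<beta> (b' * ?m) = (3, True)"
        by auto
      ultimately show ?case using 2 step.hyps(1)
        by (cases "block_all n \<beta> b") (auto simp del: mult_Suc ctl.simps)
    next
      assume 3: "ctl n \<beta> (b * ?m) = (3, True) \<and>
        (\<exists>p. 1 \<le> p \<and> p < b \<and> block_all n \<beta> p \<and> ctl n \<beta> (p * ?m) = (2, True) \<and>
        (\<forall>b'. p < b' \<and> b' < b \<longrightarrow> \<not> block_all n \<beta> b' \<and> ctl n \<beta> (b' * ?m) = (3, True)))"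
      then obtain p where p: "1 \<le> p" "p < b" "block_all n \<beta> p" "ctl n \<beta> (p * ?m) = (2, True)"
        "\<And>b'. p < b' \<Longrightarrow> b' < b \<Longrightarrow> \<not> block_all n \<beta> b' \<and> ctl n \<beta> (b' * ?m) = (3, True)" by blast
      have eq: "ctl n \<beta> (Suc b * ?m) = (if block_all n \<beta> b then Suc 3 else 3, True)"
        using 3 by (intro ctl_next_block le(1)) auto
      have nb: "\<not> block_all n \<beta> b"
      proof
        assume "block_all n \<beta> b"
        then show False using lt4 unfolding eq by simp
      qed
      have "\<not> block_all n \<beta> b' \<and> ctl n \<beta> (b' * ?m) = (3, True)" if "p < b'" "b' < Suc b" for b'
        using that p(5)[of b'] 3 nb by (cases "b' = b") auto
      moreover have "ctl n \<beta> (Suc b * ?m) = (3, True)" using eq nb by simp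
      ultimately show ?case using p less_Suc_eq by blast
    qed
  qed
  define q where "q = D div ?m"
  have "1 \<le> q" using \<open>?m \<le> D\<close> by (simp add: q_def div_greater_zero_iff Suc_leI)
  have qm: "q * ?m \<le> D" by (simp add: q_def)
  have D: "D < Suc q * ?m"
    unfolding q_def using dividend_less_div_times[of ?m D] by simp
  obtain P where P: "ctl n \<beta> (q * ?m) = (P, True)" "P = 2 \<or> P = 3" using inv[OF \<open>1 \<le> q\<close> qm] by blast
  \<comment> \<open>Inside a block the phase stays at \<open>P\<close>, so phase 4 can only begin
    with a new block.\<close>
  have last: "Suc D = Suc q * ?m"
  proof (rule ccontr)
    assume "Suc D \<noteq> Suc q * ?m"
    then have "Suc D - q * ?m < ?m" using D qm unfolding mult_Suc by linarith
    then have "ctl n \<beta> (q * ?m + (Suc D - q * ?m)) = (P, \<forall>a'<Suc D - q * ?m. dat n \<beta> (q * ?m + a'))"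
      using P qm by (intro ctl_within_block) auto
    moreover have "q * ?m + (Suc D - q * ?m) = Suc D" using qm by simp
    ultimately have "fst (ctl n \<beta> (Suc D)) = P" by (simp only: fst_conv)
    then show False using fin P(2) by linarith
  qed
  have "ctl n \<beta> (Suc D) = (if block_all n \<beta> q then Suc P else P, True)"
    unfolding last using P last by (intro ctl_next_block) auto
  then have "(if block_all n \<beta> q then Suc P else P) = 4" using fin by (simp only: fst_conv)
  then have q: "block_all n \<beta> q" "ctl n \<beta> (q * ?m) = (3, True)"
    using P by (auto split: if_splits)
  then obtain p where p: "1 \<le> p" "p < q" "block_all n \<beta> p" "ctl n \<beta> (p * ?m) = (2, True)"
      "\<And>b'. p < b' \<Longrightarrow> b' < q \<Longrightarrow> \<not> block_all n \<beta> b' \<and> ctl n \<beta> (b' * ?m) = (3, True)"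
    using inv[OF \<open>1 \<le> q\<close> qm] by auto
  \<comment> \<open>As long as the block is marked before \<open>a\<close>, the flag is set, and the
    check for a guess with value \<open>a\<close> speaks about this address.\<close>
  have data: "if dat n \<beta> (b * ?m + a) then x (b * ?m + a) = dat n \<beta> a else P = 3 \<longrightarrow> \<not> x (b * ?m + a) \<and> dat n \<beta> a"
    if "1 \<le> b" "b \<le> q" "ctl n \<beta> (b * ?m) = (P, True)" "2 \<le> P" "a < ?m" "\<forall>a'<a. dat n \<beta> (b * ?m + a')" for b a P
  proof -
    have "\<exists>\<kappa>. bin n \<kappa> = a" using bin_surj that(5) by blast
    then obtain \<kappa> where \<kappa>: "bin n \<kappa> = a" by blast
    have "b * ?m \<le> q * ?m" using that(2) by (intro mult_le_mono1)
    then have le: "b * ?m + a \<le> D" using that(5) last unfolding mult_Suc by linarith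
    have "?m \<le> b * ?m" using that(1) by simp
    then have "?m \<le> b * ?m + a" by (rule trans_le_add1)
    then have "jval n \<beta> \<kappa> (b * ?m + a) = dat n \<beta> a"
      using jval_eq[of "b * ?m + a" \<kappa>] le \<kappa> by simp
    moreover have "ctl n \<beta> (b * ?m + a) = (P, True)"
      using ctl_within_block[OF that(3,4,5)] le that(6) by simp
    moreover have "hit n \<beta> \<kappa> (b * ?m + a)"
      using hit_addr[of "b * ?m + a" \<kappa>] le that(5) \<kappa> by simp
    ultimately show ?thesis
      using checks[OF le, of \<kappa>] that(4) unfolding chk_def by (simp only: fst_conv snd_conv simp_thms) (elim conjE, assumption)
  qed
  show thesis
  proof (rule that[OF p(1,2)])
    show "x (p * ?m + a) = dat n \<beta> a" if "a < ?m" for a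
      using data[of p 2 a] p that unfolding block_all_def by simp
    show "x (q * ?m + a) = dat n \<beta> a" if "a < ?m" for a
      using data[of q 3 a] q \<open>1 \<le> q\<close> that unfolding block_all_def by simp
    fix b assume b: "p < b" "b < q"
    then have "\<exists>a. a < ?m \<and> \<not> dat n \<beta> (b * ?m + a)" using p(5) by (auto simp: block_all_def)
    \<comment> \<open>At the first unmarked address the block has bit 0 and \<open>j\<close> has bit
      1; the marks before it give agreement.\<close>
    then obtain a where a: "a < ?m" "\<not> dat n \<beta> (b * ?m + a)"
      and least: "\<And>a'. a' < a \<Longrightarrow> \<not> (a' < ?m \<and> \<not> dat n \<beta> (b * ?m + a'))"
      using exists_least_iff[of "\<lambda>a. a < ?m \<and> \<not> dat n \<beta> (b * ?m + a)"] by blast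
    have dat: "dat n \<beta> (b * ?m + a')" if "a' < a" for a' using least that a(1) by auto
    show "val ?m (\<lambda>a. x (b * ?m + a)) < val ?m (dat n \<beta>)"
    proof (rule val_less_if_lex[OF a(1)])
      have c3: "ctl n \<beta> (b * ?m) = (3, True)" using p(5) b by blast
      show "x (b * ?m + a') = dat n \<beta> a'" if "a' < a" for a'
        using data[of b 3 a'] c3 b dat that a(1) by simp
      show "\<not> x (b * ?m + a)" "dat n \<beta> a"
        using data[of b 3 a] c3 b dat a by simp_all
    qed
  qed
qed

text \<open>Completeness: a true claim passes at every address. \<open>early\<close> clears the flag
  in the first slot of each block before \<open>p\<close>, so nothing is claimed there;
  \<open>mid\<close> marks exactly the common prefix with \<open>j\<close>, so that a block below
  \<open>j\<close> is first unmarked where it has bit 0 and \<open>j\<close> has bit 1.\<close>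

lemma honest_accepted:
  assumes n: "1 \<le> n" and addr: "\<And>s. bin n (\<lambda>t. \<beta> (pos n s t)) = s mod 2 ^ n"
    and pq: "1 \<le> p" "p < q"
    and j: "\<And>a. a < 2 ^ n \<Longrightarrow> x (p * 2 ^ n + a) = dat n \<beta> a" "\<And>a. a < 2 ^ n \<Longrightarrow> x (q * 2 ^ n + a) = dat n \<beta> a"
    and all: "block_all n \<beta> p" "block_all n \<beta> q"
    and early: "\<And>b. 1 \<le> b \<Longrightarrow> b < p \<Longrightarrow> \<not> dat n \<beta> (b * 2 ^ n)"
    and mid: "\<And>b a. p < b \<Longrightarrow> b < q \<Longrightarrow> a < 2 ^ n \<Longrightarrow>
      dat n \<beta> (b * 2 ^ n + a) \<longleftrightarrow> (\<forall>a'\<le>a. x (b * 2 ^ n + a') = dat n \<beta> a')"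
    and less: "\<And>b. p < b \<Longrightarrow> b < q \<Longrightarrow> val (2 ^ n) (\<lambda>a. x (b * 2 ^ n + a)) < val (2 ^ n) (dat n \<beta>)"
  shows "\<exists>D. fst (ctl n \<beta> (Suc D)) = 4 \<and> (\<forall>s\<le>D. fst (ctl n \<beta> s) < 4) \<and> (\<forall>\<kappa>. \<forall>s\<le>D. chk n \<beta> x \<kappa> s)"
proof -
  let ?m = "2 ^ n :: nat"
  obtain D where D: "Suc D = Suc q * ?m" by (cases "Suc q * ?m") auto
  interpret good_addresses n \<beta> "Suc D" using n addr by unfold_locales auto
  have le: "Suc b * ?m \<le> Suc D" if "b \<le> q" for b
    unfolding D using that by (intro mult_le_mono1) simp
  have c2: "ctl n \<beta> (b * ?m) = (2, True)" if "1 \<le> b" "b \<le> p" for b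
    using that
  proof (induction b rule: dec_induct)
    case base
    then show ?case using ctl_block1 le[of 0] by simp
  next
    case (step b)
    have "\<not> block_all n \<beta> b"
    proof
      assume "block_all n \<beta> b"
      then have "dat n \<beta> (b * ?m + 0)" unfolding block_all_def using two_le by fastforce
      then show False using early[of b] step by simp
    qed
    then show ?case using ctl_next_block[of b 2] step le[of b] pq by simp
  qed
  have c3: "ctl n \<beta> (b * ?m) = (3, True)" if "Suc p \<le> b" "b \<le> q" for b
    using that
  proof (induction b rule: dec_induct)
    case base
    then show ?case using ctl_next_block[of p 2] c2[of p] pq all(1) le[of p] by simp
  next
    case (step b)
    have b: "p < b" "b < q" using step by auto
    have "\<not> block_all n \<beta> b"
    proof
      assume "block_all n \<beta> b"
      then have "x (b * ?m + a) = dat n \<beta> a" if "a < ?m" for a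
        using mid[OF b that] that unfolding block_all_def by blast
      then have "val ?m (\<lambda>a. x (b * ?m + a)) = val ?m (dat n \<beta>)" by (intro val_cong) auto
      then show False using less[OF b] by simp
    qed
    then show ?case using ctl_next_block[of b 3] step le[of b] by simp
  qed
  have c4: "fst (ctl n \<beta> (Suc D)) = 4"
    unfolding D using ctl_next_block[of q 3] c3[of q] pq all(2) le[of q] by (simp del: mult_Suc)
  have slot: "\<exists>b a P. s = b * ?m + a \<and> a < ?m \<and> 1 \<le> b \<and> b \<le> q \<and> (P = (if b \<le> p then 2 else 3)) \<and>
      ctl n \<beta> s = (P, \<forall>a'<a. dat n \<beta> (b * ?m + a'))" if "?m \<le> s" "s \<le> D" for s
  proof -
    let ?b = "s div ?m" and ?a = "s mod ?m"
    have "s < Suc q * ?m" using that D by linarith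
    then have "?b < Suc q" by (simp only: div_less_iff_less_mult zero_less_power zero_less_numeral)
    then have bq: "?b \<le> q" by simp
    have b1: "1 \<le> ?b" using that(1) by (simp add: div_greater_zero_iff Suc_leI)
    have s: "s = ?b * ?m + ?a" by (rule div_mult_mod_eq[symmetric])
    let ?P = "if ?b \<le> p then 2 else 3 :: nat"
    have "ctl n \<beta> (?b * ?m) = (?P, True)" using c2[of ?b] c3[of ?b] b1 bq by simp
    then have "ctl n \<beta> (?b * ?m + ?a) = (?P, \<forall>a'<?a. dat n \<beta> (?b * ?m + a'))"
      using that(2) s by (intro ctl_within_block) auto
    then have "ctl n \<beta> s = (?P, \<forall>a'<?a. dat n \<beta> (?b * ?m + a'))" by (simp only: s[symmetric])
    moreover have "?a < ?m" by simp
    ultimately show ?thesis using bq b1 s by blast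
  qed
  have lt4: "fst (ctl n \<beta> s) < 4" if "s \<le> D" for s
  proof (cases "?m \<le> s")
    case True
    then show ?thesis using slot[OF True that] by auto
  next
    case False
    then show ?thesis using phase_block0[of s] that by (cases "s = 0") auto
  qed
  have "chk n \<beta> x \<kappa> s" if s: "s \<le> D" for \<kappa> s
    unfolding chk_def
  proof (intro conjI impI)
    assume *: "0 < s \<and> hit n \<beta> \<kappa> (s - 1)"
    then have "bin n \<kappa> = (s - 1) mod ?m" using hit_addr[of "s - 1"] s by simp
    then have "bin n (incr \<kappa>) = bin n (\<lambda>t. \<beta> (pos n s t))"
      using * by (simp add: bin_incr assms(2) mod_Suc_eq)
    then show "\<forall>u<n. \<beta> (pos n s u) = incr \<kappa> u" by (simp add: bin_eq_iff)
  next
    assume 0: "fst (ctl n \<beta> s) = 0"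
    have "s = 0"
    proof (rule ccontr)
      assume "s \<noteq> 0"
      then show False using 0 phase_block0[of s] phase_ge2[of s] s by (cases "s < ?m") auto
    qed
    then show "\<forall>u<n. \<not> \<beta> (pos n s u)" using assms(2)[of 0] by (simp add: bin_eq_0_iff)
  next
    assume *: "2 \<le> fst (ctl n \<beta> s) \<and> snd (ctl n \<beta> s) \<and> hit n \<beta> \<kappa> s"
    have ms: "?m \<le> s"
    proof (rule ccontr)
      assume "\<not> ?m \<le> s"
      then show False using * phase_block0[of s] s by (cases "s = 0") auto
    qed
    obtain b a P where ba: "s = b * ?m + a" "a < ?m" "1 \<le> b" "b \<le> q" "P = (if b \<le> p then 2 else 3)"
      "ctl n \<beta> s = (P, \<forall>a'<a. dat n \<beta> (b * ?m + a'))" using slot[OF ms s] by blast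
    have sn: "\<forall>a'<a. dat n \<beta> (b * ?m + a')" using * ba(6) by simp
    have "bin n \<kappa> = a" using * hit_addr[of s \<kappa>] s ba(1,2) by simp
    then have jv: "jval n \<beta> \<kappa> s = dat n \<beta> a" using jval_eq[of s \<kappa>] ms s by simp
    have ph: "fst (ctl n \<beta> s) = P" using ba(6) by simp
    consider "b = p \<or> b = q" | "p < b" "b < q" | "b < p" using ba(4) by linarith
    then show "if dat n \<beta> s then x s = jval n \<beta> \<kappa> s else fst (ctl n \<beta> s) = 3 \<longrightarrow> \<not> x s \<and> jval n \<beta> \<kappa> s"
      unfolding jv ph
    proof cases
      case 1
      then have "dat n \<beta> s" "x s = dat n \<beta> a" using all j ba(1,2) unfolding block_all_def by blast+
      then show "if dat n \<beta> s then x s = dat n \<beta> a else P = 3 \<longrightarrow> \<not> x s \<and> dat n \<beta> a" by simp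
    next
      case 2
      have eq: "dat n \<beta> s \<longleftrightarrow> (\<forall>a'\<le>a. x (b * ?m + a') = dat n \<beta> a')" using mid[OF 2 ba(2)] ba(1) by simp
      have below: "x (b * ?m + a') = dat n \<beta> a'" if "a' < a" for a'
        using mid[OF 2, of a'] sn that ba(2) by auto
      \<comment> \<open>If the first difference went the other way, block \<open>b\<close> would
        exceed \<open>j\<close>, against \<open>less\<close>.\<close>
      have "\<not> (x s \<and> \<not> dat n \<beta> a)"
      proof
        assume "x s \<and> \<not> dat n \<beta> a"
        then have "val ?m (dat n \<beta>) < val ?m (\<lambda>a. x (b * ?m + a))"
          using below ba(1) by (intro val_less_if_lex[OF ba(2)]) auto
        then show False using less[OF 2] by simp
      qed
      moreover have "x s \<noteq> dat n \<beta> a" if "\<not> dat n \<beta> s"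
        using that eq below ba(1) le_less by blast
      ultimately show "if dat n \<beta> s then x s = dat n \<beta> a else P = 3 \<longrightarrow> \<not> x s \<and> dat n \<beta> a"
        using eq ba(1) by auto
    next
      case 3
      have nd: "\<not> dat n \<beta> (b * ?m)" using early[of b] ba(3) 3 by simp
      have "a = 0"
      proof (rule ccontr)
        assume "a \<noteq> 0"
        then have "dat n \<beta> (b * ?m + 0)" using sn by blast
        then show False using nd by simp
      qed
      then show "if dat n \<beta> s then x s = dat n \<beta> a else P = 3 \<longrightarrow> \<not> x s \<and> dat n \<beta> a"
        using nd ba 3 by simp
    qed
  qed
  then show ?thesis using c4 lt4 by blast
qed

section \<open>Plays\<close>

lemma length_concat_ge: "(\<And>i. 1 \<le> length (us i)) \<Longrightarrow> r \<le> length (concat (map us [0..<r]))"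
proof (induction r)
  case (Suc r)
  have "Suc r \<le> length (concat (map us [0..<r])) + length (us r)"
    using Suc.IH[OF Suc.prems] Suc.prems[of r] by linarith
  then show ?case by simp
qed simp

lemma concat_map_upt_append:
  "r \<le> r' \<Longrightarrow> concat (map us [0..<r']) = concat (map us [0..<r]) @ concat (map us [r..<r'])"
  by (metis concat_append map_append upt_add_eq_append zero_le le_add_diff_inverse)

text \<open>No round is empty, so the first \<open>Suc i\<close> rounds, in which
  \<open>flat\<close> looks up position \<open>i\<close>, do contain it; every other prefix that
  contains the position has the same letter there.\<close>

lemma flat_prefix:
  assumes "\<And>i. 1 \<le> length (us i)" "i < length (concat (map us [0..<r]))"
  shows "concat (map us [0..<r]) ! i = flat us i"
proof -
  have i: "i < length (concat (map us [0..<Suc i]))"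
    using length_concat_ge[of us "Suc i"] assms(1) by (meson Suc_le_lessD)
  show ?thesis
  proof (cases "r \<le> Suc i")
    case True
    then show ?thesis
      unfolding flat_def using concat_map_upt_append[OF True, of us] assms(2) by (simp only: nth_append if_True)
  next
    case False
    then have "Suc i \<le> r" by simp
    then show ?thesis
      unfolding flat_def using concat_map_upt_append[of "Suc i" r us] i by (simp only: nth_append if_True)
  qed
qed

lemma length_concat_map_upt: "(\<And>i. length (us i) = g i) \<Longrightarrow> length (concat (map us [0..<r])) = sum g {..<r}"
  by (induction r) auto

lemma flat_nth:
  assumes "\<And>i. length (us i) = g i" "\<And>i. 1 \<le> g i" "sum g {..<r} \<le> P" "P < sum g {..<Suc r}"
  shows "flat us P = us r ! (P - sum g {..<r})"
proof -
  have "flat us P = concat (map us [0..<Suc r]) ! P"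
    using assms by (intro flat_prefix[symmetric]) (simp_all only: length_concat_map_upt)
  also have "\<dots> = us r ! (P - sum g {..<r})"
    using assms by (simp add: nth_append length_concat_map_upt[of us g, OF assms(1)])
  finally show ?thesis .
qed

text \<open>Since no round is empty, position \<open>P\<close> is filled in a round
  \<open>r \<le> P\<close>, when at most \<open>P\<close> letters of Player O are known.\<close>

lemma round_exists:
  fixes g :: "nat \<Rightarrow> nat"
  assumes "\<And>i. 1 \<le> g i"
  shows "\<exists>r\<le>P. sum g {..<r} \<le> P \<and> P < sum g {..<Suc r}"
proof -
  have ge: "r \<le> sum g {..<r}" for r
  proof (induction r)
    case (Suc r)
    then show ?case using assms[of r] by simp
  qed simp
  have "\<exists>r. P < sum g {..<r}" using ge[of "Suc P"] by (intro exI[of _ "Suc P"]) simp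
  then obtain r where r: "P < sum g {..<r}" "\<And>r'. r' < r \<Longrightarrow> \<not> P < sum g {..<r'}"
    using exists_least_iff[of "\<lambda>r. P < sum g {..<r}"] by blast
  then obtain r0 where "r = Suc r0" by (cases r) auto
  moreover then have "r0 \<le> P" using r(2)[of r0] ge[of r0] by simp
  ultimately show ?thesis using r(1) r(2)[of r0] by (intro exI[of _ r0]) simp
qed

section \<open>Player O wins with sufficient lookahead\<close>

definition abits :: "nat \<Rightarrow> nat \<Rightarrow> nat \<Rightarrow> bool" where
  "abits n k = (SOME f. bin n f = k)"

lemma bin_abits: "k < 2 ^ n \<Longrightarrow> bin n (abits n k) = k"
  unfolding abits_def using someI_ex[OF bin_surj] .

text \<open>The truthful data bits, made to meet the hypotheses of \<open>honest_accepted\<close>;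
  copying block \<open>p\<close> into block 0 commits to \<open>j\<close>.\<close>

definition hdat :: "nat \<Rightarrow> (nat \<Rightarrow> bool) \<Rightarrow> nat \<Rightarrow> nat \<Rightarrow> nat \<Rightarrow> nat \<Rightarrow> bool" where
  "hdat m x p q b a =
    (if b = 0 then x (p * m + a)
     else b = p \<or> b = q \<or> p < b \<and> b < q \<and> (\<forall>a'\<le>a. x (b * m + a') = x (p * m + a')))"

definition honest :: "nat \<Rightarrow> (nat \<Rightarrow> bool) \<Rightarrow> nat \<Rightarrow> nat \<Rightarrow> nat \<Rightarrow> bool" where
  "honest n x p q i = (let s = i div Suc n; t = i mod Suc n in
    if t < n then abits n (s mod 2 ^ n) t else hdat (2 ^ n) x p q (s div 2 ^ n) (s mod 2 ^ n))"

text \<open>The bound on \<open>q\<close> comes from \<open>bad_pair_exists\<close> for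
  \<open>2 ^ m\<close> values and a window starting at block 1; it makes a finite lookahead
  sufficient.\<close>

definition bad_pair :: "nat \<Rightarrow> (nat \<Rightarrow> bool) \<Rightarrow> nat \<Rightarrow> nat \<Rightarrow> bool" where
  "bad_pair m x p q \<longleftrightarrow> 1 \<le> p \<and> p < q \<and> q \<le> 2 ^ 2 ^ m \<and> (\<forall>a<m. x (p * m + a) = x (q * m + a)) \<and>
    (\<forall>b. p < b \<and> b < q \<longrightarrow> val m (\<lambda>a. x (b * m + a)) < val m (\<lambda>a. x (p * m + a)))"

lemma bad_pair_ex: "\<exists>p q. bad_pair m x p q"
proof -
  obtain p q where "1 \<le> p" "p < q" "q < 1 + 2 ^ 2 ^ m"
    "val m (\<lambda>a. x (p * m + a)) = val m (\<lambda>a. x (q * m + a))"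
    "\<forall>b. p < b \<and> b < q \<longrightarrow> val m (\<lambda>a. x (b * m + a)) < val m (\<lambda>a. x (p * m + a))"
    using bad_pair_exists[of 1 "2 ^ m" "\<lambda>b. val m (\<lambda>a. x (b * m + a))"] val_less by blast
  then have "bad_pair m x p q" by (simp add: bad_pair_def val_eq_iff)
  then show ?thesis by blast
qed

lemma honest_addr: "bin n (\<lambda>t. honest n x p q (pos n s t)) = s mod 2 ^ n"
proof -
  have "bin n (\<lambda>t. honest n x p q (pos n s t)) = bin n (abits n (s mod 2 ^ n))"
    by (rule bin_cong) (simp add: honest_def pos_div pos_mod Let_def)
  then show ?thesis by (simp add: bin_abits)
qed

lemma dat_honest: "a < 2 ^ n \<Longrightarrow> dat n (honest n x p q) (b * 2 ^ n + a) = hdat (2 ^ n) x p q b a"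
  by (simp add: dat_def honest_def pos_div pos_mod Let_def)

text \<open>\<open>x\<close> is the view that Player O has of the data of Player I; it need only be
  correct up to block \<open>q\<close>.\<close>

lemma honest_in_lang:
  assumes n: "1 \<le> n" and bp: "bad_pair (2 ^ n) (idat n w) p q" and w: "obit w = honest n x p q"
    and x: "\<And>s. s < Suc q * 2 ^ n \<Longrightarrow> x s = idat n w s"
  shows "\<exists>\<kappa>. (\<exists>i. 4 \<le> phase (gorun n \<kappa> w i)) \<and> (\<forall>i. ok (gorun n \<kappa> w i))"
proof -
  let ?m = "2 ^ n :: nat"
  have pq: "1 \<le> p" "p < q" using bp by (auto simp: bad_pair_def)
  have xs: "x (b * ?m + a) = idat n w (b * ?m + a)" if "b \<le> q" "a < ?m" for b a
  proof (rule x)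
    have "b * ?m + a < Suc b * ?m" using that by simp
    also have "\<dots> \<le> Suc q * ?m" using that by (intro mult_le_mono1) simp
    finally show "b * ?m + a < Suc q * ?m" .
  qed
  have d: "dat n (obit w) (b * ?m + a) = hdat ?m x p q b a" if "a < ?m" for a b
    unfolding w using that by (rule dat_honest)
  have d0: "dat n (obit w) a = idat n w (p * ?m + a)" if "a < ?m" for a
    using d[of a 0] that xs[of p a] pq by (simp add: hdat_def)
  have "\<exists>D. fst (ctl n (obit w) (Suc D)) = 4 \<and> (\<forall>s\<le>D. fst (ctl n (obit w) s) < 4) \<and>
    (\<forall>\<kappa>. \<forall>s\<le>D. chk n (obit w) (idat n w) \<kappa> s)"
  proof (rule honest_accepted[OF n _ pq])
    show "bin n (\<lambda>t. obit w (pos n s t)) = s mod ?m" for s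
      unfolding fun_cong[OF w] by (rule honest_addr)
    show "idat n w (p * ?m + a) = dat n (obit w) a" if "a < ?m" for a using d0[OF that] by simp
    show "idat n w (q * ?m + a) = dat n (obit w) a" if "a < ?m" for a
      using d0[OF that] bp that unfolding bad_pair_def by blast
    show "block_all n (obit w) p" "block_all n (obit w) q"
      using d pq by (simp_all add: block_all_def hdat_def)
    show "\<not> dat n (obit w) (b * ?m)" if "1 \<le> b" "b < p" for b
      using d[of 0 b] that pq by (simp add: hdat_def)
    fix b assume b: "p < b" "b < q"
    show "dat n (obit w) (b * ?m + a) \<longleftrightarrow> (\<forall>a'\<le>a. idat n w (b * ?m + a') = dat n (obit w) a')"
      if "a < ?m" for a
    proof -
      have "dat n (obit w) (b * ?m + a) \<longleftrightarrow> (\<forall>a'\<le>a. x (b * ?m + a') = x (p * ?m + a'))"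
        using d[OF that, of b] b pq unfolding hdat_def by simp
      moreover have "(x (b * ?m + a') = x (p * ?m + a')) = (idat n w (b * ?m + a') = dat n (obit w) a')" if "a' \<le> a" for a'
      proof -
        have "a' < ?m" using that \<open>a < ?m\<close> by simp
        then show ?thesis using xs[of b a'] xs[of p a'] d0[of a'] b by simp
      qed
      ultimately show ?thesis by blast
    qed
    have "val ?m (dat n (obit w)) = val ?m (\<lambda>a. idat n w (p * ?m + a))"
      using d0 by (intro val_cong)
    then show "val ?m (\<lambda>a. idat n w (b * ?m + a)) < val ?m (dat n (obit w))"
      using bp b unfolding bad_pair_def by metis
  qed
  then obtain D where D: "fst (ctl n (obit w) (Suc D)) = 4" "\<And>s. s \<le> D \<Longrightarrow> fst (ctl n (obit w) s) < 4"
    "\<And>\<kappa> s. s \<le> D \<Longrightarrow> chk n (obit w) (idat n w) \<kappa> s" by blast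
  \<comment> \<open>The guess is the address spelled in the first challenge; the claim passes at
    every address, so any challenge can be met.\<close>
  define \<kappa> where "\<kappa> u = (\<exists>P. first_chal w (pos n (Suc D) 0) P \<and> fst (w (Suc P + u)) = 1)" for u
  have "(fst (w (Suc P + u)) = 1) = \<kappa> u" if P: "first_chal w (pos n (Suc D) 0) P" for P u
  proof -
    have "P' = P" if "first_chal w (pos n (Suc D) 0) P'" for P'
      using that P unfolding first_chal_def by (metis linorder_neqE_nat)
    then show ?thesis using P unfolding \<kappa>_def by blast
  qed
  then show ?thesis using slots_accepted[OF D(1,2,3), of \<kappa>] by blast
qed

lemma O_wins_language:
  assumes n: "1 \<le> n"
    and L: "\<And>w. (\<And>i. w i \<in> {0, 1, 2} \<times> {0, 1}) \<Longrightarrow>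
      (\<exists>\<kappa>. (\<exists>i. 4 \<le> phase (gorun n \<kappa> w i)) \<and> (\<forall>i. ok (gorun n \<kappa> w i))) \<Longrightarrow> w \<in> L"
  shows "\<exists>f. constant_delay f \<and> O_wins {0, 1, 2} {0, 1} f L"
proof -
  \<comment> \<open>The initial lookahead covers block \<open>2 ^ 2 ^ 2 ^ n\<close>, the last in
    which \<open>q\<close> can lie.\<close>
  define F where "F = pos n (Suc (2 ^ 2 ^ 2 ^ n) * 2 ^ n) 0"
  have "0 < F" by (simp add: F_def pos_def)
  define f where "f i = (if i = 0 then F else 1)" for i :: nat
  have f: "constant_delay f" using \<open>0 < F\<close> by (simp add: f_def constant_delay_def delay_fun_def)
  \<comment> \<open>Cutting off at \<open>F\<close> makes this view, and hence the chosen pair, the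
    same in all rounds.\<close>
  define X where "X ws s = (pos n s n < F \<and> ws ! pos n s n = (1::nat))" for ws s
  define pq where "pq ws = (SOME pq. bad_pair (2 ^ n) (X ws) (fst pq) (snd pq))" for ws
  \<comment> \<open>\<open>length ws - F\<close> is the position of the letter that is due.\<close>
  define \<tau> where "\<tau> ws = (if honest n (X ws) (fst (pq ws)) (snd (pq ws)) (length ws - F) then 1 else 0 :: nat)" for ws
  have "O_wins {0, 1, 2} {0, 1} f L"
    unfolding O_wins_def
  proof (intro exI[of _ \<tau>] conjI allI impI)
    show "\<tau> ws \<in> {0, 1}" for ws by (simp add: \<tau>_def)
    fix us :: "nat \<Rightarrow> nat list"
    assume us: "\<forall>i. length (us i) = f i \<and> set (us i) \<subseteq> {0, 1, 2}"
    let ?ws = "\<lambda>k. concat (map us [0..<Suc k])"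
    have len: "length (us i) = f i" for i using us by blast
    have len1: "1 \<le> length (us i)" for i using len[of i] \<open>0 < F\<close> by (simp add: f_def)
    have lenk: "length (?ws k) = F + k" for k
    proof (induction k)
      case 0
      then show ?case using len[of 0] by (simp add: f_def)
    next
      case (Suc k)
      have "length (?ws (Suc k)) = length (?ws k) + length (us (Suc k))" by simp
      then show ?case using Suc len[of "Suc k"] by (simp only:) (simp add: f_def)
    qed
    have nth: "?ws k ! i = flat us i" if "i < F + k" for i k
      using that lenk[of k] by (intro flat_prefix[OF len1]) (simp only:)
    define x where "x s = (pos n s n < F \<and> flat us (pos n s n) = 1)" for s
    have X: "X (?ws k) = x" for k
      using nth[of _ k] by (intro ext) (auto simp only: X_def x_def trans_less_add1)
    define p q where "p = fst (SOME pq. bad_pair (2 ^ n) x (fst pq) (snd pq))"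
      and "q = snd (SOME pq. bad_pair (2 ^ n) x (fst pq) (snd pq))"
    have "\<exists>pq. bad_pair (2 ^ n) x (fst pq) (snd pq)" using bad_pair_ex[of "2 ^ n" x] by auto
    then have bp: "bad_pair (2 ^ n) x p q" unfolding p_def q_def by (rule someI_ex)
    define w where "w k = (flat us k, \<tau> (?ws k))" for k
    have \<tau>: "\<tau> (?ws k) = (if honest n x p q k then 1 else 0)" for k
      unfolding \<tau>_def X pq_def lenk p_def q_def by simp
    have flat_in: "flat us k \<in> {0, 1, 2}" for k
    proof -
      have "k < length (?ws k)" using lenk[of k] \<open>0 < F\<close> by simp
      then have "flat us k \<in> set (?ws k)" unfolding flat_def by (rule nth_mem)
      then show ?thesis using us by fastforce
    qed
    have "w \<in> L"
    proof (rule L)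
      show "w i \<in> {0, 1, 2} \<times> {0, 1}" for i using flat_in[of i] \<tau>[of i] by (simp only: w_def) simp
      show "\<exists>\<kappa>. (\<exists>i. 4 \<le> phase (gorun n \<kappa> w i)) \<and> (\<forall>i. ok (gorun n \<kappa> w i))"
      proof (rule honest_in_lang[OF n])
        have xw: "x s = idat n w s" if "s < Suc (2 ^ 2 ^ 2 ^ n) * 2 ^ n" for s
          using pos_less[OF that, of n n] by (simp add: x_def w_def F_def)
        have q: "q \<le> 2 ^ 2 ^ 2 ^ n" using bp by (simp add: bad_pair_def)
        then have "Suc q * 2 ^ n \<le> Suc (2 ^ 2 ^ 2 ^ n) * 2 ^ n" by (intro mult_le_mono1) simp
        then show xq: "x s = idat n w s" if "s < Suc q * 2 ^ n" for s
          using xw[of s] that by linarith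
        have xb: "x (b * 2 ^ n + a) = idat n w (b * 2 ^ n + a)" if "b \<le> q" "a < 2 ^ n" for b a
        proof (rule xq)
          have "b * 2 ^ n + a < Suc b * 2 ^ n" using that by simp
          also have "\<dots> \<le> Suc q * 2 ^ n" using that by (intro mult_le_mono1) simp
          finally show "b * 2 ^ n + a < Suc q * 2 ^ n" .
        qed
        have val: "val (2 ^ n) (\<lambda>a. x (b * 2 ^ n + a)) = val (2 ^ n) (\<lambda>a. idat n w (b * 2 ^ n + a))" if "b \<le> q" for b
          using xb[OF that] by (intro val_cong)
        show "bad_pair (2 ^ n) (idat n w) p q"
          unfolding bad_pair_def
        proof (intro conjI allI impI)
          show "1 \<le> p" "p < q" "q \<le> 2 ^ 2 ^ 2 ^ n" using bp by (auto simp: bad_pair_def)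
          then show "idat n w (p * 2 ^ n + a) = idat n w (q * 2 ^ n + a)" if "a < 2 ^ n" for a
            using xb[of p a] xb[of q a] bp that unfolding bad_pair_def by simp
          show "val (2 ^ n) (\<lambda>a. idat n w (b * 2 ^ n + a)) < val (2 ^ n) (\<lambda>a. idat n w (p * 2 ^ n + a))"
            if "p < b \<and> b < q" for b
          proof -
            have "val (2 ^ n) (\<lambda>a. x (b * 2 ^ n + a)) < val (2 ^ n) (\<lambda>a. x (p * 2 ^ n + a))"
              using bp that unfolding bad_pair_def by blast
            then show ?thesis using val[of b] val[of p] that by simp
          qed
        qed
        show "obit w = honest n x p q"
          by (intro ext) (simp only: w_def snd_conv \<tau>, simp)
      qed
    qed
    then show "(\<lambda>k. (flat us k, \<tau> (?ws k))) \<in> L" unfolding w_def .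
  qed
  then show ?thesis using f by blast
qed

section \<open>Player I wins against little lookahead\<close>

definition rbits :: "nat \<Rightarrow> nat \<Rightarrow> nat \<Rightarrow> bool" where
  "rbits m b = (SOME d. val m d = ruler b)"

lemma val_rbits:
  assumes "0 < b" "b < 2 ^ 2 ^ m"
  shows "val m (rbits m b) = ruler b"
  unfolding rbits_def using someI_ex[OF val_surj[OF ruler_less[OF assms]]] .

text \<open>The ruler blocks can be played before \<open>j\<close> is known. The complement of
  \<open>j\<close> differs from \<open>j\<close> at every address, so no later block can serve as
  \<open>q\<close>.\<close>

definition ibase :: "nat \<Rightarrow> (nat \<Rightarrow> bool) \<Rightarrow> nat \<Rightarrow> bool" where
  "ibase n \<beta> s = (if s div 2 ^ n < 2 ^ 2 ^ 2 ^ n then rbits (2 ^ n) (s div 2 ^ n) (s mod 2 ^ n)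
    else \<not> dat n \<beta> (s mod 2 ^ n))"

definition finished :: "nat \<Rightarrow> (nat \<Rightarrow> bool) \<Rightarrow> nat \<Rightarrow> bool" where
  "finished n \<beta> D \<longleftrightarrow> fst (ctl n \<beta> (Suc D)) = 4 \<and> (\<forall>s\<le>D. fst (ctl n \<beta> s) < 4)"

text \<open>An address at which the claim fails when judged against \<open>ibase\<close>; for
  finished claims \<open>ibase_no_bad_pair\<close> guarantees that one exists.\<close>

definition kstar :: "nat \<Rightarrow> (nat \<Rightarrow> bool) \<Rightarrow> nat \<Rightarrow> bool" where
  "kstar n \<beta> = (SOME \<kappa>. \<exists>D. finished n \<beta> D \<and> (\<exists>s\<le>D. \<not> chk n \<beta> (ibase n \<beta>) \<kappa> s))"

text \<open>Letters not yet played count as False, so that a finite prefix can be passed to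
  functions of infinite sequences.\<close>

definition lbit :: "nat list \<Rightarrow> nat \<Rightarrow> bool" where
  "lbit vs i \<longleftrightarrow> i < length vs \<and> vs ! i = 1"

definition known :: "nat \<Rightarrow> nat list \<Rightarrow> bool" where
  "known n vs \<longleftrightarrow> (\<exists>D. finished n (lbit vs) D \<and> pos n (Suc D) 0 \<le> length vs)"

text \<open>Player I need not respect slot boundaries between rounds: once O's claim is complete, letter 2 at
  every data position makes the \<open>n\<close> letters after the first of them spell \<open>kstar\<close>.\<close>

definition iletter :: "nat \<Rightarrow> nat list \<Rightarrow> nat \<Rightarrow> nat" where
  "iletter n vs P =
    (if known n vs then if P mod Suc n = n then 2 else if kstar n (lbit vs) (P mod Suc n) then 1 else 0
     else if ibase n (lbit vs) (P div Suc n) then 1 else 0)"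

section \<open>Dependence of Player I's choices on finite prefixes of O's letters\<close>

lemma finished_unique: "finished n \<beta> D \<Longrightarrow> finished n \<beta> D' \<Longrightarrow> D = D'"
proof (rule ccontr)
  assume "finished n \<beta> D" "finished n \<beta> D'" "D \<noteq> D'"
  then consider "Suc D \<le> D'" | "Suc D' \<le> D" by linarith
  then show False
  proof cases
    case 1
    then show False using \<open>finished n \<beta> D\<close> \<open>finished n \<beta> D'\<close> unfolding finished_def by (metis less_irrefl)
  next
    case 2
    then show False using \<open>finished n \<beta> D\<close> \<open>finished n \<beta> D'\<close> unfolding finished_def by (metis less_irrefl)
  qed
qed

lemma slot_cong:
  assumes "\<And>i. i < pos n (Suc s) 0 \<Longrightarrow> \<beta> i = \<beta>' i"
  shows "hit n \<beta> \<kappa> s = hit n \<beta>' \<kappa> s" "full n \<beta> s = full n \<beta>' s" "dat n \<beta> s = dat n \<beta>' s"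
    "u < n \<Longrightarrow> \<beta> (pos n s u) = \<beta>' (pos n s u)"
proof -
  have "\<beta> (pos n s u) = \<beta>' (pos n s u)" if "u \<le> n" for u
    using pos_less[of s "Suc s" u n] that by (intro assms) simp
  then show "hit n \<beta> \<kappa> s = hit n \<beta>' \<kappa> s" "full n \<beta> s = full n \<beta>' s" "dat n \<beta> s = dat n \<beta>' s"
    "u < n \<Longrightarrow> \<beta> (pos n s u) = \<beta>' (pos n s u)"
    by (simp_all add: hit_def full_def dat_def)
qed

lemma ctl_jval_cong:
  assumes "\<And>i. i < pos n s 0 \<Longrightarrow> \<beta> i = \<beta>' i"
  shows "ctl n \<beta> s = ctl n \<beta>' s \<and> jval n \<beta> \<kappa> s = jval n \<beta>' \<kappa> s"
  using assms
proof (induction s)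
  case (Suc s)
  have "\<beta> i = \<beta>' i" if "i < pos n s 0" for i
    using Suc.prems that pos_mono[of s "Suc s" n] by simp
  then have IH: "ctl n \<beta> s = ctl n \<beta>' s \<and> jval n \<beta> \<kappa> s = jval n \<beta>' \<kappa> s" using Suc.IH by blast
  note slot_cong[of n s \<beta> \<beta>', OF Suc.prems]
  then show ?case using IH by (simp only: ctl.simps jval.simps)
qed simp

lemma chk_cong:
  assumes "\<And>i. i < pos n (Suc s) 0 \<Longrightarrow> \<beta> i = \<beta>' i" "x s = x' s"
  shows "chk n \<beta> x \<kappa> s = chk n \<beta>' x' \<kappa> s"
proof -
  have less: "\<beta> i = \<beta>' i" if "i < pos n s 0" for i
    using assms(1) that pos_mono[of s "Suc s" n] by simp
  have "(0 < s \<and> hit n \<beta> \<kappa> (s - 1)) = (0 < s \<and> hit n \<beta>' \<kappa> (s - 1))"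
  proof (cases s)
    case (Suc s')
    then show ?thesis using slot_cong(1)[of n s' \<beta> \<beta>' \<kappa>] less by simp
  qed simp
  moreover have "ctl n \<beta> s = ctl n \<beta>' s" "jval n \<beta> \<kappa> s = jval n \<beta>' \<kappa> s"
    using ctl_jval_cong[of n s \<beta> \<beta>' \<kappa>] less by blast+
  moreover note slot_cong[of n s \<beta> \<beta>', OF assms(1)]
  ultimately show ?thesis using assms(2) unfolding chk_def by (simp only: cong: all_cong1 imp_cong)
qed

lemma finished_cong:
  assumes "\<And>i. i < pos n (Suc D) 0 \<Longrightarrow> \<beta> i = \<beta>' i"
  shows "finished n \<beta> D = finished n \<beta>' D"
proof -
  have "ctl n \<beta> s = ctl n \<beta>' s" if "s \<le> Suc D" for s
  proof -
    have "\<beta> i = \<beta>' i" if "i < pos n s 0" for i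
      using assms that pos_mono[OF \<open>s \<le> Suc D\<close>, of n] by simp
    then show ?thesis using ctl_jval_cong by blast
  qed
  then show ?thesis unfolding finished_def by (metis le_SucI order_refl)
qed

lemma ibase_cong:
  assumes "2 ^ 2 ^ 2 ^ n \<le> s div 2 ^ n \<Longrightarrow> (\<And>i. i < pos n (2 ^ n) 0 \<Longrightarrow> \<beta> i = \<beta>' i)"
  shows "ibase n \<beta> s = ibase n \<beta>' s"
proof (cases "s div 2 ^ n < 2 ^ 2 ^ 2 ^ n")
  case False
  then have "\<beta> i = \<beta>' i" if "i < pos n (2 ^ n) 0" for i using assms that by simp
  moreover have "pos n (s mod 2 ^ n) n < pos n (2 ^ n) 0" by (intro pos_less) auto
  ultimately have "dat n \<beta> (s mod 2 ^ n) = dat n \<beta>' (s mod 2 ^ n)" by (simp add: dat_def)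
  then show ?thesis by (simp add: ibase_def)
qed (simp add: ibase_def)

text \<open>Once the claim is complete, Player I computes the same challenge address in every later
  round.\<close>

lemma kstar_cong:
  assumes "\<And>i. i < pos n (Suc D) 0 \<Longrightarrow> \<beta> i = \<beta>' i" "finished n \<beta> D"
  shows "kstar n \<beta> = kstar n \<beta>'"
proof -
  have fin': "finished n \<beta>' D" using finished_cong[of n D \<beta> \<beta>', OF assms(1)] assms(2) by blast
  have "chk n \<beta> (ibase n \<beta>) \<kappa> s = chk n \<beta>' (ibase n \<beta>') \<kappa> s" if "s \<le> D" for \<kappa> s
  proof (rule chk_cong)
    have le: "pos n (Suc s) 0 \<le> pos n (Suc D) 0" using that by (intro pos_mono) simp
    then show "\<beta> i = \<beta>' i" if "i < pos n (Suc s) 0" for i using assms(1) that by simp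
    show "ibase n \<beta> s = ibase n \<beta>' s"
    proof (rule ibase_cong)
      assume "2 ^ 2 ^ 2 ^ n \<le> s div 2 ^ n"
      then have "1 \<le> s div 2 ^ n" using one_le_power[of "2::nat"] by (meson le_trans one_le_numeral)
      then have "2 ^ n \<le> s" by (metis One_nat_def Suc_le_eq div_greater_zero_iff)
      then have "pos n (2 ^ n) 0 \<le> pos n (Suc D) 0" using that by (intro pos_mono) simp
      then show "\<beta> i = \<beta>' i" if "i < pos n (2 ^ n) 0" for i using assms(1) that by simp
    qed
  qed
  moreover have "finished n \<beta> D' \<longleftrightarrow> D' = D" "finished n \<beta>' D' \<longleftrightarrow> D' = D" for D'
    using assms(2) fin' finished_unique by blast+
  ultimately show ?thesis unfolding kstar_def by (simp cong: conj_cong)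
qed

text \<open>A challenge determines the guess on its first \<open>n\<close> bits only, so agreement
  with \<open>kstar\<close> is available just there.\<close>

lemma chk_cong_guess:
  assumes "\<And>u. u < n \<Longrightarrow> \<kappa> u = \<kappa>' u"
  shows "chk n \<beta> x \<kappa> s = chk n \<beta> x \<kappa>' s"
proof -
  have h: "hit n \<beta> \<kappa> s = hit n \<beta> \<kappa>' s" for s using assms by (simp add: hit_def)
  have "jval n \<beta> \<kappa> s = jval n \<beta> \<kappa>' s" by (induction s) (simp_all only: jval.simps h)
  moreover have "incr \<kappa> u = incr \<kappa>' u" if "u < n" for u
    using assms that by (simp add: incr_def)
  ultimately show ?thesis unfolding chk_def h by (simp cong: imp_cong)
qed

text \<open>If \<open>q\<close> lies among the ruler blocks, \<open>ruler_between\<close> yields a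
  larger value between \<open>p\<close> and \<open>q\<close>; otherwise block \<open>q\<close> is
  the complement of \<open>j\<close> and already differs at address 0.\<close>

lemma ibase_no_bad_pair:
  assumes n: "1 \<le> n" and "finished n \<beta> D" "\<And>\<kappa> s. s \<le> D \<Longrightarrow> chk n \<beta> (ibase n \<beta>) \<kappa> s"
  shows False
proof -
  let ?m = "2 ^ n :: nat"
  let ?x = "ibase n \<beta>"
  obtain p q where pq: "1 \<le> p" "p < q" "\<And>a. a < ?m \<Longrightarrow> ?x (p * ?m + a) = dat n \<beta> a"
    "\<And>a. a < ?m \<Longrightarrow> ?x (q * ?m + a) = dat n \<beta> a"
    "\<And>b. p < b \<Longrightarrow> b < q \<Longrightarrow> val ?m (\<lambda>a. ?x (b * ?m + a)) < val ?m (dat n \<beta>)"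
    using bad_pair_if_all_checks[OF n, of \<beta> D ?x] assms(2,3) unfolding finished_def by blast
  show False
  proof (cases "q < 2 ^ 2 ^ ?m")
    case True
    have val: "val ?m (\<lambda>a. ?x (b * ?m + a)) = ruler b" if "1 \<le> b" "b \<le> q" for b
    proof -
      have "val ?m (\<lambda>a. ?x (b * ?m + a)) = val ?m (rbits ?m b)"
        using that True by (intro val_cong) (simp add: ibase_def)
      then show ?thesis using val_rbits[of b ?m] that True by simp
    qed
    have "val ?m (\<lambda>a. ?x (p * ?m + a)) = val ?m (dat n \<beta>)" "val ?m (\<lambda>a. ?x (q * ?m + a)) = val ?m (dat n \<beta>)"
      using pq(3,4) by (auto intro!: val_cong)
    then have eq: "val ?m (dat n \<beta>) = ruler p" "ruler p = ruler q" using val[of p] val[of q] pq(1,2) by auto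
    then obtain b where "p < b" "b < q" "ruler p < ruler b" using ruler_between[of p q] pq(1,2) by auto
    then show False using pq(1) pq(5)[of b] val[of b] eq by simp
  next
    case False
    then have "?x (q * ?m + 0) = (\<not> dat n \<beta> 0)" by (simp add: ibase_def)
    then show False using pq(4)[of 0] by simp
  qed
qed

text \<open>Player I plays \<open>ibase\<close> until the claim is complete and then challenges at
  \<open>kstar\<close>. Acceptance would force the guess to agree with \<open>kstar\<close>, so the
  claim would pass there, hence by the choice of \<open>kstar\<close> everywhere, against
  \<open>ibase_no_bad_pair\<close>.\<close>

lemma I_wins_language:
  assumes n: "1 \<le> n" and g: "delay_fun g" and small: "(\<Sum>i\<le>(n + 2) * 2 ^ n. g i) \<le> 2 ^ 2 ^ 2 ^ n"
    and L: "\<And>w. w \<in> L \<Longrightarrow> \<exists>\<kappa>. (\<exists>i. 4 \<le> phase (gorun n \<kappa> w i)) \<and> (\<forall>i. ok (gorun n \<kappa> w i))"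
  shows "I_wins {0, 1, 2} {0, 1} g L"
proof -
  let ?m = "2 ^ n :: nat"
  let ?G = "\<lambda>r. sum g {..<r}"
  have g1: "1 \<le> g i" for i using g by (simp add: delay_fun_def)
  define \<tau> where "\<tau> vs = map (iletter n vs) [?G (length vs)..<?G (Suc (length vs))]" for vs
  have len: "length (\<tau> vs) = g (length vs)" for vs by (simp add: \<tau>_def)
  show ?thesis
    unfolding I_wins_def
  proof (intro exI[of _ \<tau>] conjI ballI allI impI)
    show "length (\<tau> vs) = g (length vs)" for vs by (rule len)
    show "set (\<tau> vs) \<subseteq> {0, 1, 2}" for vs by (auto simp: \<tau>_def iletter_def)
    fix vs :: "nat \<Rightarrow> nat"
    let ?us = "\<lambda>i. \<tau> (map vs [0..<i])"
    define w where "w k = (flat ?us k, vs k)" for k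
    define \<beta> where "\<beta> = obit w"
    have lbit: "lbit (map vs [0..<r]) i = (i < r \<and> \<beta> i)" for r i
      by (auto simp: lbit_def \<beta>_def w_def)
    have letter: "fst (w P) = iletter n (map vs [0..<r]) P" if "?G r \<le> P" "P < ?G (Suc r)" for r P
    proof -
      have "flat ?us P = ?us r ! (P - ?G r)" using that g1 by (intro flat_nth) (simp_all add: len)
      also have "\<dots> = iletter n (map vs [0..<r]) P" using that by (simp add: \<tau>_def)
      finally show ?thesis by (simp add: w_def)
    qed
    have mono: "?G r \<le> ?G r'" if "r \<le> r'" for r r' using that by (intro sum_mono2) auto
    show "(\<lambda>k. (flat ?us k, vs k)) \<notin> L"
    proof
      assume "(\<lambda>k. (flat ?us k, vs k)) \<in> L"
      then have "w \<in> L" unfolding w_def .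
      then obtain \<kappa> i where acc: "4 \<le> phase (gorun n \<kappa> w i)" "\<And>i. ok (gorun n \<kappa> w i)" using L by blast
      obtain D where D: "fst (ctl n \<beta> (Suc D)) = 4" "\<And>s. s \<le> D \<Longrightarrow> fst (ctl n \<beta> s) < 4"
        "\<And>s. s \<le> D \<Longrightarrow> chk n \<beta> (idat n w) \<kappa> s"
        "\<And>P u. first_chal w (pos n (Suc D) 0) P \<Longrightarrow> u < n \<Longrightarrow> (fst (w (Suc P + u)) = 1) = \<kappa> u"
        using accepted_slots[OF acc] unfolding \<beta>_def by blast
      have fin: "finished n \<beta> D" using D(1,2) by (simp only: finished_def) blast
      let ?Q = "pos n (Suc D) 0"
      have known: "known n (map vs [0..<r]) \<longleftrightarrow> ?Q \<le> r" for r
      proof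
        assume "known n (map vs [0..<r])"
        then obtain D' where D': "finished n (lbit (map vs [0..<r])) D'" "pos n (Suc D') 0 \<le> r"
          by (auto simp: known_def)
        then have "finished n \<beta> D'"
          using finished_cong[of n D' "lbit (map vs [0..<r])" \<beta>] lbit by simp
        then show "?Q \<le> r" using finished_unique[OF fin] D'(2) by simp
      next
        assume r: "?Q \<le> r"
        then have "finished n (lbit (map vs [0..<r])) D"
          using finished_cong[of n D "lbit (map vs [0..<r])" \<beta>] lbit fin by simp
        then show "known n (map vs [0..<r])" using r unfolding known_def by auto
      qed
      have kst: "kstar n (lbit (map vs [0..<r])) = kstar n \<beta>" if "?Q \<le> r" for r
        using that lbit by (intro kstar_cong[OF _ fin, symmetric]) simp
      \<comment> \<open>A position before \<open>?Q\<close> is filled in a round before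
        \<open>?Q\<close>, when the claim is still incomplete, so it carries a letter of
        \<open>ibase\<close>.\<close>
      have base: "idat n w s = ibase n \<beta> s" if "s \<le> D" for s
      proof -
        let ?P = "pos n s n"
        obtain r where r: "r \<le> ?P" "?G r \<le> ?P" "?P < ?G (Suc r)" using round_exists[of g ?P] g1 by blast
        have "?P < ?Q" using that by (intro pos_less) auto
        then have "\<not> known n (map vs [0..<r])" using known r(1) by simp
        then have "idat n w s = ibase n (lbit (map vs [0..<r])) s"
          using letter[OF r(2,3)] by (simp add: iletter_def pos_div)
        also have "\<dots> = ibase n \<beta> s"
        proof (rule ibase_cong)
          fix i assume big: "2 ^ 2 ^ ?m \<le> s div ?m" and i: "i < pos n ?m 0"
          have "s div ?m \<le> s" by simp
          also have "s \<le> ?P" by (simp add: pos_def)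
          finally have "2 ^ 2 ^ ?m \<le> ?P" using big by simp
          \<comment> \<open>The rounds up to \<open>(n + 2) * 2 ^ n\<close> fill at most
            \<open>2 ^ 2 ^ 2 ^ n\<close> positions. So \<open>?P\<close> is filled later, when the
            \<open>(n + 1) * 2 ^ n\<close> letters of O's block 0 are known.\<close>
          then have "?G (Suc ((n + 2) * ?m)) \<le> ?P" using small by (simp only: lessThan_Suc_atMost)
          then have "\<not> Suc r \<le> Suc ((n + 2) * ?m)" using mono[of "Suc r"] r(3) by fastforce
          then have "pos n ?m 0 \<le> r" by (simp add: pos_def algebra_simps)
          then show "lbit (map vs [0..<r]) i = \<beta> i" using i lbit by simp
        qed
        finally show ?thesis .
      qed
      have chk: "chk n \<beta> (ibase n \<beta>) \<kappa> s" if "s \<le> D" for s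
        using D(3)[OF that] chk_cong[of n s \<beta> \<beta> "idat n w" "ibase n \<beta>"] base[OF that] by blast
      have late: "?Q \<le> r" if "?G ?Q \<le> P" "P < ?G (Suc r)" for r P
      proof (rule ccontr)
        assume "\<not> ?Q \<le> r"
        then show False using mono[of "Suc r" ?Q] that by simp
      qed
      \<comment> \<open>\<open>?G ?Q\<close> serves as a slot number: that slot ends at a position
        at least as large, which is filled in round \<open>?Q\<close> or later.\<close>
      have "fst (w (pos n (?G ?Q) n)) = 2"
      proof -
        let ?P = "pos n (?G ?Q) n"
        obtain r where r: "?G r \<le> ?P" "?P < ?G (Suc r)" using round_exists[of g ?P] g1 by blast
        have "?G ?Q \<le> ?P" by (simp add: pos_def)
        then have "?Q \<le> r" using late r(2) by blast
        then show ?thesis using letter[OF r] known by (simp add: iletter_def pos_mod)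
      qed
      moreover have "?Q \<le> pos n (?G ?Q) n"
      proof -
        have "?Q \<le> ?G ?Q" using sum_mono[of "{..<?Q}" "\<lambda>_. 1" g] g1 by simp
        then show ?thesis by (simp add: pos_def)
      qed
      ultimately obtain P where P: "first_chal w ?Q P" using first_chal_exists by blast
      obtain r where r: "?G r \<le> P" "P < ?G (Suc r)" using round_exists[of g P] g1 by blast
      have "fst (w P) = 2" using P by (simp add: first_chal_def)
      \<comment> \<open>Letter 2 is played only after the claim is complete and only at data
        positions, so the address letters of the next slot follow it.\<close>
      then have Pr: "?Q \<le> r" "P mod Suc n = n"
        using letter[OF r] known[of r] by (auto simp: iletter_def split: if_splits)
      have "\<kappa> u = kstar n \<beta> u" if u: "u < n" for u
      proof -
        let ?P = "Suc P + u"
        have "P = pos n (P div Suc n) n" using pos_div_mod[of n P] Pr(2) by simp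
        then have "?P = pos n (Suc (P div Suc n)) u" by (simp add: pos_def)
        then have mod: "?P mod Suc n = u" using u by (simp add: pos_mod)
        obtain r' where r': "?G r' \<le> ?P" "?P < ?G (Suc r')" using round_exists[of g ?P] g1 by blast
        have "r \<le> r'"
        proof (rule ccontr)
          assume "\<not> r \<le> r'"
          then show False using mono[of "Suc r'" r] r(1) r'(2) by simp
        qed
        then have "?Q \<le> r'" using Pr(1) by simp
        then have "(fst (w ?P) = 1) = kstar n \<beta> u"
          using letter[OF r'] known[of r'] kst[of r'] mod u by (simp add: iletter_def)
        then show ?thesis using D(4)[OF P u] by simp
      qed
      then have "chk n \<beta> (ibase n \<beta>) (kstar n \<beta>) s" if "s \<le> D" for s
        using chk[OF that] chk_cong_guess[of n \<kappa> "kstar n \<beta>" \<beta> "ibase n \<beta>" s] by blast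
      then have "\<not> (\<exists>D'. finished n \<beta> D' \<and> (\<exists>s\<le>D'. \<not> chk n \<beta> (ibase n \<beta>) (kstar n \<beta>) s))"
        using finished_unique[OF fin] by blast
      \<comment> \<open>\<open>kstar\<close> satisfies its defining property whenever some address
        does; as it fails no check, no address fails one.\<close>
      then have "\<not> (\<exists>D'. finished n \<beta> D' \<and> (\<exists>s\<le>D'. \<not> chk n \<beta> (ibase n \<beta>) \<kappa>' s))" for \<kappa>'
        using someI[of "\<lambda>\<kappa>. \<exists>D'. finished n \<beta> D' \<and> (\<exists>s\<le>D'. \<not> chk n \<beta> (ibase n \<beta>) \<kappa> s)" \<kappa>']
        unfolding kstar_def by blast
      then have "chk n \<beta> (ibase n \<beta>) \<kappa>' s" if "s \<le> D" for \<kappa>' s using fin that by blast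
      then show False using ibase_no_bad_pair[OF n fin] by blast
    qed
  qed
qed


text \<open>The left side is \<open>9216 * (n + 1) ^ 2 + 7 * n + 20\<close>; as
  \<open>(n + 1) ^ 2 \<le> 4 * n ^ 3\<close> for positive \<open>n\<close>, even 36891 would do as
  the constant.\<close>

lemma size_bound:
  fixes n :: nat
  assumes "1 \<le> n"
  shows "6 * (1536 * Suc n) * Suc n + 7 * n + 20 \<le> 40000 * n ^ 3"
proof -
  obtain k where "n = Suc k" using assms by (cases n) auto
  then show ?thesis by (simp add: power3_eq_cube algebra_simps)
qed

theorem theorem5:
  shows "\<exists>c::nat. \<forall>n::nat. n \<ge> 1 \<longrightarrow>
    (\<exists>(SI :: nat set) (SO :: nat set) (A :: (nat, nat \<times> nat) wm_aut).
       finite SI \<and> SI \<noteq> {} \<and> finite SO \<and> SO \<noteq> {} \<and>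
       wf_wm A \<and> alph A = SI \<times> SO \<and> wm_size A \<le> c * n ^ 3 \<and>
       (\<exists>f. constant_delay f \<and> O_wins SI SO f (wm_lang A)) \<and>
       (\<forall>g. delay_fun g \<and> (\<Sum>i\<le>(n + 2) * 2 ^ n. g i) \<le> 2 ^ 2 ^ 2 ^ n
            \<longrightarrow> I_wins SI SO g (wm_lang A)))"
proof (intro exI[of _ 40000] allI impI)
  fix n :: nat assume n: "1 \<le> n"
  let ?S = "{0, 1, 2::nat} \<times> {0, 1::nat}"
  obtain A :: "(nat, nat \<times> nat) wm_aut" where A: "wf_wm A" "alph A = ?S"
    "wm_size A \<le> 6 * (1536 * Suc n) * Suc n + 7 * n + 20"
    "wm_lang A = {w. (\<forall>i. w i \<in> ?S) \<and>
      (\<exists>\<kappa>. (\<exists>i. 4 \<le> phase (gorun n \<kappa> w i)) \<and> (\<forall>i. ok (gorun n \<kappa> w i)))}"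
    using automaton_exists[of ?S n] by auto
  have size: "wm_size A \<le> 40000 * n ^ 3"
    using A(3) size_bound[OF n] by (rule order_trans)
  have O: "\<exists>f. constant_delay f \<and> O_wins {0, 1, 2} {0, 1} f (wm_lang A)"
    by (rule O_wins_language[OF n]) (simp add: A(4))
  have I: "I_wins {0, 1, 2} {0, 1} g (wm_lang A)"
    if "delay_fun g \<and> (\<Sum>i\<le>(n + 2) * 2 ^ n. g i) \<le> 2 ^ 2 ^ 2 ^ n" for g
    using that by (intro I_wins_language[OF n]) (auto simp: A(4))
  show "\<exists>(SI :: nat set) (SO :: nat set) (A :: (nat, nat \<times> nat) wm_aut).
       finite SI \<and> SI \<noteq> {} \<and> finite SO \<and> SO \<noteq> {} \<and>
       wf_wm A \<and> alph A = SI \<times> SO \<and> wm_size A \<le> 40000 * n ^ 3 \<and>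
       (\<exists>f. constant_delay f \<and> O_wins SI SO f (wm_lang A)) \<and>
       (\<forall>g. delay_fun g \<and> (\<Sum>i\<le>(n + 2) * 2 ^ n. g i) \<le> 2 ^ 2 ^ 2 ^ n
            \<longrightarrow> I_wins SI SO g (wm_lang A))"
    by (intro exI[of _ "{0, 1, 2}"] exI[of _ "{0, 1}"] exI[of _ A] conjI allI impI)
      (rule A(1) A(2) size O I | assumption | simp)+
qed

end
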